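(* Let $M$ be a Riemannian $n$-manifold. If $M$ admits a totally real isometric immersion into a complex Euclidean space which satisfies $$\delta_q^{\mathrm{Ric}}>\frac{n(n-q-1)}{n-q}H^2$$ for some positive integer $q\leq\frac{n}{2}$ at some point, then $M$ is not an Einstein manifold.
   Context: Intrinsic notions. Let $M$ be a Riemannian $n$-manifold. $K(\pi)$ denotes the sectional curvature of a plane section $\pi\subset T_pM$. For a unit vector $X\in T_pM$, $\mathrm{Ric}(X)=\sum_{j=2}^n K(X\wedge e_j)$, where $\{e_1=X,e_2,\ldots,e_n\}$ is an orthonormal basis of $T_pM$. $M$ is Einstein if $\mathrm{Ric}(X)$ is independent of the choice of the unit vector $X$; then $\mathrm{Ric}(X)=\frac{2}{n}\tau(p)$ for every unit $X\in T_pM$, where $\tau(p)=\sum_{1\le i<j\le n}K(e_i\wedge e_j)$. For a positive integer $q\le n/2$ define $$K_q^{\inf}(p)=\inf_{\pi_1\perp\cdots\perp\pi_q}\frac{K(\pi_1)+\cdots+K(\pi_q)}{q},$$ where $\pi_1,\ldots,\pi_q$ run over all $q$ mutually orthogonal plane sections in $T_pM$, and define the function $\delta_q^{\mathrm{Ric}}$ on $M$ by $$\delta_q^{\mathrm{Ric}}(p)=\sup_{X\in T_p^1M}\mathrm{Ric}(X)-\frac{2q}{n}K_q^{\inf}(p),\qquad T_p^1M=\{X\in T_pM:\|X\|=1\}.$$ Extrinsic notions. A complex Euclidean space is $\mathbb{C}^m$ with its standard flat Kähler metric and complex structure $J$. An isometric immersion of $M$ into $\mathbb{C}^m$ is totally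 real if $J$ carries each tangent space $T_pM$ (identified with its image) into the corresponding normal space $T_p^\perp M$. With $h$ the second fundamental form of the immersion, the mean curvature vector is $\overrightarrow{H}=\frac1n\operatorname{trace}h$, and $H=\|\overrightarrow{H}\|$. *)

theory Defs
  imports "HOL-Analysis.Analysis"
begin

section \<open>Smooth maps between Euclidean spaces\<close>

text \<open>To be used on open sets only, since the derivatives are two-sided.\<close>

primrec C_k_on :: "nat \<Rightarrow> ('a::euclidean_space \<Rightarrow> 'b::euclidean_space) \<Rightarrow> 'a set \<Rightarrow> bool" where
  "C_k_on 0 f S \<longleftrightarrow> continuous_on S f"
| "C_k_on (Suc k) f S \<longleftrightarrow> (\<forall>x\<in>S. f differentiable (at x)) \<and>
     (\<forall>v. C_k_on k (\<lambda>x. frechet_derivative f (at x) v) S)"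

definition smooth_on :: "'a set \<Rightarrow> ('a::euclidean_space \<Rightarrow> 'b::euclidean_space) \<Rightarrow> bool" where
  "smooth_on S f \<longleftrightarrow> (\<forall>k. C_k_on k f S)"


section \<open>Riemannian manifolds\<close>

text \<open>A chart is its domain together with its coordinate map.\<close>

type_synonym ('m, 'n) chart = "'m set \<times> ('m \<Rightarrow> real ^ 'n)"

abbreviation cdom :: "('m, 'n) chart \<Rightarrow> 'm set" where "cdom c \<equiv> fst c"
abbreviation coord :: "('m, 'n) chart \<Rightarrow> 'm \<Rightarrow> real ^ 'n" where "coord c \<equiv> snd c"
abbreviation param :: "('m, 'n) chart \<Rightarrow> real ^ 'n \<Rightarrow> 'm" where
  "param c \<equiv> inv_into (cdom c) (coord c)"

text \<open>A manifold of dimension \<open>n = CARD('n)\<close> is given by a smooth atlas, which need not be maximal.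
  In \<open>metric M c x u v\<close> the point and the two tangent vectors are given by their coordinates
  \<open>x\<close>, \<open>u\<close>, \<open>v\<close> with respect to the chart \<open>c\<close>.\<close>

record ('m, 'n::finite) riemannian_data =
  mtop :: "'m topology"
  atlas :: "('m, 'n) chart set"
  metric :: "('m, 'n) chart \<Rightarrow> real ^ 'n \<Rightarrow> real ^ 'n \<Rightarrow> real ^ 'n \<Rightarrow> real"

abbreviation points :: "('m, 'n::finite) riemannian_data \<Rightarrow> 'm set" where
  "points M \<equiv> topspace (mtop M)"

definition smooth_manifold :: "('m, 'n::finite) riemannian_data \<Rightarrow> bool" where
  "smooth_manifold M \<longleftrightarrow>
     Hausdorff_space (mtop M) \<and> second_countable (mtop M) \<and>
     (\<Union>c\<in>atlas M. cdom c) = points M \<and>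
     (\<forall>c\<in>atlas M. openin (mtop M) (cdom c) \<and> open (coord c ` cdom c) \<and>
        homeomorphic_map (subtopology (mtop M) (cdom c)) (top_of_set (coord c ` cdom c)) (coord c)) \<and>
     (\<forall>c\<in>atlas M. \<forall>d\<in>atlas M. smooth_on (coord c ` (cdom c \<inter> cdom d)) (coord d \<circ> param c))"

definition riemannian_metric :: "('m, 'n::finite) riemannian_data \<Rightarrow> bool" where
  "riemannian_metric M \<longleftrightarrow>
     (\<forall>c\<in>atlas M. \<forall>u v. smooth_on (coord c ` cdom c) (\<lambda>x. metric M c x u v)) \<and>
     (\<forall>c\<in>atlas M. \<forall>x\<in>coord c ` cdom c.
        bilinear (metric M c x) \<and>
        (\<forall>u v. metric M c x u v = metric M c x v u) \<and>
        (\<forall>u. u \<noteq> 0 \<longrightarrow> metric M c x u u > 0)) \<and>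
     (\<forall>c\<in>atlas M. \<forall>d\<in>atlas M. \<forall>x\<in>coord c ` (cdom c \<inter> cdom d). \<forall>u v.
        let \<phi> = coord d \<circ> param c; D = frechet_derivative \<phi> (at x)
        in metric M c x u v = metric M d (\<phi> x) (D u) (D v))"

definition riemannian_manifold :: "('m, 'n::finite) riemannian_data \<Rightarrow> bool" where
  "riemannian_manifold M \<longleftrightarrow> smooth_manifold M \<and> riemannian_metric M"


section \<open>Tangent spaces\<close>

text \<open>The tangent space at \<open>p\<close> is identified with \<open>real ^ 'n\<close> by the coordinates of a chart around
  \<open>p\<close> that is chosen once and for all. Every pointwise notion below is written in these coordinates;
  its value does not depend on the choice, as all of them are tensorial.\<close>

definition chart_at :: "('m, 'n::finite) riemannian_data \<Rightarrow> 'm \<Rightarrow> ('m, 'n) chart" where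
  "chart_at M p = (SOME c. c \<in> atlas M \<and> p \<in> cdom c)"

definition local_metric ::
  "('m, 'n::finite) riemannian_data \<Rightarrow> 'm \<Rightarrow> real ^ 'n \<Rightarrow> real ^ 'n \<Rightarrow> real ^ 'n \<Rightarrow> real" where
  "local_metric M p = metric M (chart_at M p)"

definition point_at :: "('m, 'n::finite) riemannian_data \<Rightarrow> 'm \<Rightarrow> real ^ 'n" where
  "point_at M p = coord (chart_at M p) p"

definition tangent_inner :: "('m, 'n::finite) riemannian_data \<Rightarrow> 'm \<Rightarrow> real ^ 'n \<Rightarrow> real ^ 'n \<Rightarrow> real" where
  "tangent_inner M p = local_metric M p (point_at M p)"

definition unit_tangent :: "('m, 'n::finite) riemannian_data \<Rightarrow> 'm \<Rightarrow> (real ^ 'n) set" where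
  "unit_tangent M p = {X. tangent_inner M p X X = 1}"

definition orthonormal_basis :: "('m, 'n::finite) riemannian_data \<Rightarrow> 'm \<Rightarrow> (real ^ 'n) set \<Rightarrow> bool" where
  "orthonormal_basis M p B \<longleftrightarrow> independent B \<and> span B = UNIV \<and>
     (\<forall>u\<in>B. \<forall>v\<in>B. tangent_inner M p u v = (if u = v then 1 else 0))"

definition plane_section :: "(real ^ 'n::finite) set \<Rightarrow> bool" where
  "plane_section \<pi> \<longleftrightarrow> subspace \<pi> \<and> dim \<pi> = 2"

definition orthogonal_planes ::
  "('m, 'n::finite) riemannian_data \<Rightarrow> 'm \<Rightarrow> (real ^ 'n) set \<Rightarrow> (real ^ 'n) set \<Rightarrow> bool" where
  "orthogonal_planes M p \<pi> \<sigma> \<longleftrightarrow> (\<forall>u\<in>\<pi>. \<forall>v\<in>\<sigma>. tangent_inner M p u v = 0)"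


section \<open>Curvature\<close>

text \<open>In this section \<open>G x u v\<close> is a metric in local coordinates. \<open>christoffel G x u v\<close> is
  \<open>\<nabla>\<^sub>u v\<close> at \<open>x\<close> for the vector fields with constant coefficients \<open>u\<close> and \<open>v\<close>; as these and
  all other such fields commute, the Koszul formula for the Levi-Civita connection reduces to the
  identity below.\<close>

definition christoffel ::
  "(real ^ 'n \<Rightarrow> real ^ 'n \<Rightarrow> real ^ 'n \<Rightarrow> real) \<Rightarrow> real ^ 'n \<Rightarrow> real ^ 'n \<Rightarrow> real ^ 'n \<Rightarrow> real ^ 'n::finite" where
  "christoffel G x u v = (THE w. \<forall>z. 2 * G x w z =
      frechet_derivative (\<lambda>y. G y v z) (at x) u
    + frechet_derivative (\<lambda>y. G y u z) (at x) v
    - frechet_derivative (\<lambda>y. G y u v) (at x) z)"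

definition levi_civita ::
  "(real ^ 'n \<Rightarrow> real ^ 'n \<Rightarrow> real ^ 'n \<Rightarrow> real) \<Rightarrow>
   (real ^ 'n \<Rightarrow> real ^ 'n) \<Rightarrow> (real ^ 'n \<Rightarrow> real ^ 'n) \<Rightarrow> real ^ 'n \<Rightarrow> real ^ 'n::finite" where
  "levi_civita G X Y x = frechet_derivative Y (at x) (X x) + christoffel G x (X x) (Y x)"

text \<open>\<open>R(X,Y)Z = \<nabla>\<^sub>X \<nabla>\<^sub>Y Z - \<nabla>\<^sub>Y \<nabla>\<^sub>X Z - \<nabla>\<^bsub>[X,Y]\<^esub> Z\<close>, evaluated on the vector fields with constant
  coefficients \<open>u\<close>, \<open>v\<close>, \<open>w\<close>, for which the bracket vanishes.\<close>

definition riemann_curvature ::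
  "(real ^ 'n \<Rightarrow> real ^ 'n \<Rightarrow> real ^ 'n \<Rightarrow> real) \<Rightarrow>
   real ^ 'n \<Rightarrow> real ^ 'n \<Rightarrow> real ^ 'n \<Rightarrow> real ^ 'n \<Rightarrow> real ^ 'n::finite" where
  "riemann_curvature G x u v w =
     levi_civita G (\<lambda>_. u) (levi_civita G (\<lambda>_. v) (\<lambda>_. w)) x
   - levi_civita G (\<lambda>_. v) (levi_civita G (\<lambda>_. u) (\<lambda>_. w)) x"

text \<open>The quotient is the same for every basis \<open>u, v\<close> of the plane.\<close>

definition sectional_curvature ::
  "('m, 'n::finite) riemannian_data \<Rightarrow> 'm \<Rightarrow> (real ^ 'n) set \<Rightarrow> real" where
  "sectional_curvature M p \<pi> =
     (let (u, v) = (SOME (u, v). u \<noteq> v \<and> independent {u, v} \<and> span {u, v} = \<pi>);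
          g = tangent_inner M p;
          R = riemann_curvature (local_metric M p) (point_at M p)
      in g (R u v v) u / (g u u * g v v - (g u v)\<^sup>2))"

text \<open>The sum is the same for every orthonormal basis containing the unit vector \<open>X\<close>.\<close>

definition ricci :: "('m, 'n::finite) riemannian_data \<Rightarrow> 'm \<Rightarrow> real ^ 'n \<Rightarrow> real" where
  "ricci M p X =
     (let B = (SOME B. orthonormal_basis M p B \<and> X \<in> B)
      in \<Sum>e\<in>B - {X}. sectional_curvature M p (span {X, e}))"

text \<open>The value of \<open>ricci\<close> may depend on the point, as in \<open>Ric(X) = 2 \<tau>(p) / n\<close>.\<close>

definition einstein :: "('m, 'n::finite) riemannian_data \<Rightarrow> bool" where
  "einstein M \<longleftrightarrow>
     (\<forall>p\<in>points M. \<forall>X\<in>unit_tangent M p. \<forall>Y\<in>unit_tangent M p. ricci M p X = ricci M p Y)"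

definition K_inf :: "('m, 'n::finite) riemannian_data \<Rightarrow> nat \<Rightarrow> 'm \<Rightarrow> real" where
  "K_inf M q p = Inf {(\<Sum>i<q. sectional_curvature M p (\<pi> i)) / real q | \<pi> :: nat \<Rightarrow> (real ^ 'n) set.
     (\<forall>i<q. plane_section (\<pi> i)) \<and>
     (\<forall>i<q. \<forall>j<q. i \<noteq> j \<longrightarrow> orthogonal_planes M p (\<pi> i) (\<pi> j))}"

definition delta_Ric :: "('m, 'n::finite) riemannian_data \<Rightarrow> nat \<Rightarrow> 'm \<Rightarrow> real" where
  "delta_Ric M q p =
     (SUP X\<in>unit_tangent M p. ricci M p X) - 2 * real q / real CARD('n) * K_inf M q p"


section \<open>Totally real isometric immersions into complex Euclidean space\<close>

text \<open>The inner product of \<open>complex ^ 'k\<close> is the real part of the Hermitian one, hence the standard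
  flat Kaehler metric; \<open>J\<close> is its complex structure.\<close>

definition J :: "complex ^ 'k \<Rightarrow> complex ^ 'k" where
  "J v = \<i> *s v"

definition in_chart :: "('m \<Rightarrow> complex ^ 'k) \<Rightarrow> ('m, 'n) chart \<Rightarrow> real ^ 'n \<Rightarrow> complex ^ 'k" where
  "in_chart f c = f \<circ> param c"

definition isometric_immersion ::
  "('m, 'n::finite) riemannian_data \<Rightarrow> ('m \<Rightarrow> complex ^ 'k::finite) \<Rightarrow> bool" where
  "isometric_immersion M f \<longleftrightarrow>
     (\<forall>c\<in>atlas M. smooth_on (coord c ` cdom c) (in_chart f c) \<and>
        (\<forall>x\<in>coord c ` cdom c. let D = frechet_derivative (in_chart f c) (at x)
           in inj D \<and> (\<forall>u v. metric M c x u v = D u \<bullet> D v)))"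

definition pushforward ::
  "('m, 'n::finite) riemannian_data \<Rightarrow> ('m \<Rightarrow> complex ^ 'k::finite) \<Rightarrow> 'm \<Rightarrow> real ^ 'n \<Rightarrow> complex ^ 'k" where
  "pushforward M f p = frechet_derivative (in_chart f (chart_at M p)) (at (point_at M p))"

definition tangent_image ::
  "('m, 'n::finite) riemannian_data \<Rightarrow> ('m \<Rightarrow> complex ^ 'k::finite) \<Rightarrow> 'm \<Rightarrow> (complex ^ 'k) set" where
  "tangent_image M f p = range (pushforward M f p)"

definition normal_space ::
  "('m, 'n::finite) riemannian_data \<Rightarrow> ('m \<Rightarrow> complex ^ 'k::finite) \<Rightarrow> 'm \<Rightarrow> (complex ^ 'k) set" where
  "normal_space M f p = orthogonal_comp (tangent_image M f p)"

definition totally_real ::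
  "('m, 'n::finite) riemannian_data \<Rightarrow> ('m \<Rightarrow> complex ^ 'k::finite) \<Rightarrow> bool" where
  "totally_real M f \<longleftrightarrow> (\<forall>p\<in>points M. J ` tangent_image M f p \<subseteq> normal_space M f p)"

text \<open>By the Gauss formula, \<open>h(u,v)\<close> is the normal component of the derivative in direction \<open>u\<close> of
  the image of a vector field extending \<open>v\<close>, here the one with constant coefficients.\<close>

definition second_fundamental_form ::
  "('m, 'n::finite) riemannian_data \<Rightarrow> ('m \<Rightarrow> complex ^ 'k::finite) \<Rightarrow> 'm \<Rightarrow>
   real ^ 'n \<Rightarrow> real ^ 'n \<Rightarrow> complex ^ 'k" where
  "second_fundamental_form M f p u v =
     (let F = in_chart f (chart_at M p);
          w = frechet_derivative (\<lambda>x. frechet_derivative F (at x) v) (at (point_at M p)) u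
      in THE z. z \<in> normal_space M f p \<and> w - z \<in> tangent_image M f p)"

text \<open>The trace of \<open>h\<close> with respect to the metric is the same for every orthonormal basis.\<close>

definition mean_curvature_vector ::
  "('m, 'n::finite) riemannian_data \<Rightarrow> ('m \<Rightarrow> complex ^ 'k::finite) \<Rightarrow> 'm \<Rightarrow> complex ^ 'k" where
  "mean_curvature_vector M f p =
     (1 / real CARD('n)) *\<^sub>R
       (\<Sum>e\<in>(SOME B. orthonormal_basis M p B). second_fundamental_form M f p e e)"

definition mean_curvature ::
  "('m, 'n::finite) riemannian_data \<Rightarrow> ('m \<Rightarrow> complex ^ 'k::finite) \<Rightarrow> 'm \<Rightarrow> real" where
  "mean_curvature M f p = norm (mean_curvature_vector M f p)"

end

theory Submission
  imports Defs
begin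

text \<open>On an Einstein manifold \<open>Ric(X) = 2 \<tau>(p) / n\<close>, so an upper bound for \<open>delta_Ric\<close> amounts to
  one for \<open>\<tau> - (K(\<pi>\<^sub>1) + \<dots> + K(\<pi>\<^sub>q))\<close> over mutually orthogonal planes. Adapt an orthonormal
  basis to the planes and group it into \<open>n - q\<close> blocks: \<open>q\<close> pairs spanning the planes, and singletons.
  By the Gauss equation the difference is a sum of \<open>\<langle>h(e,e), h(e',e')\<rangle> - |h(e,e')|\<^sup>2\<close> over pairs from
  different blocks, hence at most the sum of the inner products of the traces of \<open>h\<close> over different
  blocks. As these \<open>n - q\<close> vectors add up to \<open>n H\<close>, Cauchy--Schwarz gives the bound
  \<open>n\<^sup>2 (n - q - 1) / (2 (n - q)) |H|\<^sup>2\<close>.\<close>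

section \<open>Derivatives of smooth maps\<close>

abbreviation deriv_at :: "('a::euclidean_space \<Rightarrow> 'b::euclidean_space) \<Rightarrow> 'a \<Rightarrow> 'a \<Rightarrow> 'b" where
  "deriv_at f x \<equiv> frechet_derivative f (at x)"

lemma smooth_on_differentiable:
  assumes "smooth_on S f" "x \<in> S"
  shows "f differentiable at x"
  using assms by (auto simp: smooth_on_def dest: spec[of _ "Suc 0"])

lemma smooth_on_continuous: "smooth_on S f \<Longrightarrow> continuous_on S f"
  unfolding smooth_on_def by (metis C_k_on.simps(1))

lemma smooth_on_deriv_at: "smooth_on S f \<Longrightarrow> smooth_on S (\<lambda>x. deriv_at f x v)"
  unfolding smooth_on_def by (metis C_k_on.simps(2))

lemma smooth_on_has_derivative:
  assumes "smooth_on S f" "x \<in> S"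
  shows "(f has_derivative deriv_at f x) (at x)"
  using smooth_on_differentiable[OF assms] by (simp add: frechet_derivative_works)

lemma linear_deriv_at:
  assumes "smooth_on S f" "x \<in> S"
  shows "linear (deriv_at f x)"
  using smooth_on_has_derivative[OF assms] has_derivative_linear by blast

lemma deriv_at_inner:
  fixes f g :: "'a::euclidean_space \<Rightarrow> 'b::euclidean_space"
  assumes "f differentiable at x" "g differentiable at x"
  shows "deriv_at (\<lambda>y. f y \<bullet> g y) x v = f x \<bullet> deriv_at g x v + deriv_at f x v \<bullet> g x"
proof -
  have "((\<lambda>y. f y \<bullet> g y) has_derivative (\<lambda>v. f x \<bullet> deriv_at g x v + deriv_at f x v \<bullet> g x)) (at x)"
    using assms[unfolded frechet_derivative_works] by (rule has_derivative_inner)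
  then show ?thesis
    by (simp add: frechet_derivative_at[symmetric])
qed

text \<open>The mean value theorem applies twice, first along \<open>u\<close> and then along
  \<open>v\<close>. The left side is unchanged when \<open>u\<close> and \<open>v\<close> are
  exchanged, which is what yields the symmetry of second derivatives.\<close>

lemma second_difference_mean_value:
  fixes f :: "'a::euclidean_space \<Rightarrow> real"
  assumes f: "\<And>y. y \<in> ball x r \<Longrightarrow> f differentiable at y"
    and df: "\<And>y. y \<in> ball x r \<Longrightarrow> (\<lambda>y. deriv_at f y u) differentiable at y"
    and t: "0 < t" "t * (norm u + norm v) < r"
  shows "\<exists>y\<in>ball x r. f (x + t *\<^sub>R u + t *\<^sub>R v) - f (x + t *\<^sub>R u) - f (x + t *\<^sub>R v) + f x
           = t * t * deriv_at (\<lambda>y. deriv_at f y u) y v"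
proof -
  have ball: "x + a *\<^sub>R u + b *\<^sub>R v \<in> ball x r" if "0 \<le> a" "a \<le> t" "0 \<le> b" "b \<le> t" for a b
  proof -
    have "norm (a *\<^sub>R u + b *\<^sub>R v) \<le> a * norm u + b * norm v"
      using norm_triangle_ineq[of "a *\<^sub>R u" "b *\<^sub>R v"] that by simp
    also have "\<dots> \<le> t * norm u + t * norm v"
      using that by (intro add_mono mult_right_mono) auto
    finally show ?thesis
      using t(2) by (simp add: dist_norm algebra_simps norm_minus_commute)
  qed
  have path: "((\<lambda>s. g (c + s *\<^sub>R w)) has_derivative (\<lambda>h. h * deriv_at g (c + s *\<^sub>R w) w)) (at s)"
    if "g differentiable at (c + s *\<^sub>R w)" for g :: "'a \<Rightarrow> real" and c w s
  proof -
    have *: "((\<lambda>s. c + s *\<^sub>R w) has_derivative (\<lambda>h. h *\<^sub>R w)) (at s)"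
      by (auto intro!: derivative_eq_intros)
    have **: "(g has_derivative deriv_at g (c + s *\<^sub>R w)) (at (c + s *\<^sub>R w))"
      using that by (simp add: frechet_derivative_works)
    then have "linear (deriv_at g (c + s *\<^sub>R w))"
      by (rule has_derivative_linear)
    with diff_chain_at[OF * **] show ?thesis
      by (simp add: o_def linear_cmul)
  qed
  \<comment> \<open>The increment of \<open>f\<close> under the shift by \<open>t\<close> times
    \<open>v\<close>, followed along \<open>u\<close>; its increment from 0 to \<open>t\<close> is
    the second difference.\<close>
  define \<phi> where "\<phi> s = f ((x + t *\<^sub>R v) + s *\<^sub>R u) - f (x + s *\<^sub>R u)" for s
  have "((\<lambda>s. f ((x + t *\<^sub>R v) + s *\<^sub>R u) - f (x + s *\<^sub>R u)) has_derivative
      (\<lambda>h. h * deriv_at f ((x + t *\<^sub>R v) + s *\<^sub>R u) u - h * deriv_at f (x + s *\<^sub>R u) u)) (at s)"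
    if "0 \<le> s" "s \<le> t" for s
    using ball[of s t] ball[of s 0] that t
    by (intro has_derivative_diff path f) (auto simp: algebra_simps)
  note d\<phi> = this
  have \<phi>: "(\<phi> has_real_derivative deriv_at f ((x + t *\<^sub>R v) + s *\<^sub>R u) u - deriv_at f (x + s *\<^sub>R u) u) (at s)"
    if "0 \<le> s" "s \<le> t" for s
    unfolding has_field_derivative_def \<phi>_def[abs_def]
    by (rule has_derivative_eq_rhs[OF d\<phi>[OF that] ext]) (simp add: algebra_simps)
  obtain \<xi> where \<xi>: "0 < \<xi>" "\<xi> < t" and
    eq1: "\<phi> t - \<phi> 0 = (t - 0) * (deriv_at f ((x + t *\<^sub>R v) + \<xi> *\<^sub>R u) u - deriv_at f (x + \<xi> *\<^sub>R u) u)"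
    using MVT2[OF t(1) \<phi>] by blast
  \<comment> \<open>The difference left by the first mean value step is the increment of this
    function from 0 to \<open>t\<close>.\<close>
  define \<psi> where "\<psi> s = deriv_at f ((x + \<xi> *\<^sub>R u) + s *\<^sub>R v) u" for s
  have "((\<lambda>s. deriv_at f ((x + \<xi> *\<^sub>R u) + s *\<^sub>R v) u) has_derivative
      (\<lambda>h. h * deriv_at (\<lambda>y. deriv_at f y u) ((x + \<xi> *\<^sub>R u) + s *\<^sub>R v) v)) (at s)"
    if "0 \<le> s" "s \<le> t" for s
    using ball[of \<xi> s] that \<xi> by (intro path df) auto
  note d\<psi> = this
  have \<psi>: "(\<psi> has_real_derivative deriv_at (\<lambda>y. deriv_at f y u) ((x + \<xi> *\<^sub>R u) + s *\<^sub>R v) v) (at s)"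
    if "0 \<le> s" "s \<le> t" for s
    unfolding has_field_derivative_def \<psi>_def[abs_def]
    by (rule has_derivative_eq_rhs[OF d\<psi>[OF that] ext]) (simp add: algebra_simps)
  obtain \<eta> where \<eta>: "0 < \<eta>" "\<eta> < t" and
    eq2: "\<psi> t - \<psi> 0 = (t - 0) * deriv_at (\<lambda>y. deriv_at f y u) ((x + \<xi> *\<^sub>R u) + \<eta> *\<^sub>R v) v"
    using MVT2[OF t(1) \<psi>] by blast
  show ?thesis
  proof
    show "x + \<xi> *\<^sub>R u + \<eta> *\<^sub>R v \<in> ball x r"
      using ball \<xi> \<eta> by simp
    show "f (x + t *\<^sub>R u + t *\<^sub>R v) - f (x + t *\<^sub>R u) - f (x + t *\<^sub>R v) + f x
        = t * t * deriv_at (\<lambda>y. deriv_at f y u) (x + \<xi> *\<^sub>R u + \<eta> *\<^sub>R v) v"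
      using eq1 eq2 unfolding \<phi>_def \<psi>_def by (simp add: algebra_simps)
  qed
qed

text \<open>Computing one second difference in both orders shows that arbitrarily close to
  \<open>x\<close> there are points \<open>y\<close> and \<open>z\<close>, possibly distinct, with
  \<open>A y = B z\<close>. Continuity of the mixed derivatives carries the equality to
  \<open>x\<close>.\<close>

lemma second_derivative_symmetric_real:
  fixes f :: "'a::euclidean_space \<Rightarrow> real"
  assumes S: "open S" "x \<in> S" and f: "smooth_on S f"
  shows "deriv_at (\<lambda>y. deriv_at f y u) x v = deriv_at (\<lambda>y. deriv_at f y v) x u"
proof -
  define A where "A = (\<lambda>y. deriv_at (\<lambda>y. deriv_at f y u) y v)"
  define B where "B = (\<lambda>y. deriv_at (\<lambda>y. deriv_at f y v) y u)"
  have cont: "isCont A x" "isCont B x"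
    using S smooth_on_continuous[OF smooth_on_deriv_at[OF smooth_on_deriv_at[OF f]]]
    unfolding A_def B_def by (auto simp: continuous_on_eq_continuous_at)
  have "\<bar>A x - B x\<bar> < e" if "e > 0" for e
  proof -
    obtain r1 where r1: "r1 > 0" "\<And>y. dist y x < r1 \<Longrightarrow> dist (A y) (A x) < e/2"
      using cont(1) \<open>e > 0\<close> unfolding continuous_at_eps_delta by (metis half_gt_zero)
    obtain r2 where r2: "r2 > 0" "\<And>y. dist y x < r2 \<Longrightarrow> dist (B y) (B x) < e/2"
      using cont(2) \<open>e > 0\<close> unfolding continuous_at_eps_delta by (metis half_gt_zero)
    obtain r3 where r3: "r3 > 0" "ball x r3 \<subseteq> S"
      using S open_contains_ball by blast
    define r where "r = min r1 (min r2 r3)"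
    have r: "r > 0" "ball x r \<subseteq> S"
      using r1 r2 r3 by (auto simp: r_def)
    \<comment> \<open>The summand 1 makes the denominator positive even for \<open>u = v = 0\<close>
      and the required inequality strict.\<close>
    define t where "t = r / (norm u + norm v + 1)"
    have pos: "norm u + norm v + 1 > 0"
      by (simp add: add_nonneg_pos)
    have t: "t > 0" "t * (norm u + norm v) < r"
    proof -
      show "t > 0" using r pos by (simp add: t_def)
      then have "t * (norm u + norm v) < t * (norm u + norm v + 1)" by simp
      also have "\<dots> = r" using pos by (simp add: t_def)
      finally show "t * (norm u + norm v) < r" .
    qed
    have diff: "f differentiable at y" "(\<lambda>y. deriv_at f y w) differentiable at y" if "y \<in> ball x r" for y w
      using that r smooth_on_differentiable[OF f] smooth_on_differentiable[OF smooth_on_deriv_at[OF f]] by auto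
    obtain y where y: "y \<in> ball x r"
      "f (x + t *\<^sub>R u + t *\<^sub>R v) - f (x + t *\<^sub>R u) - f (x + t *\<^sub>R v) + f x = t * t * A y"
      using second_difference_mean_value[of x r f u t v] diff t unfolding A_def by blast
    obtain z where z: "z \<in> ball x r"
      "f (x + t *\<^sub>R v + t *\<^sub>R u) - f (x + t *\<^sub>R v) - f (x + t *\<^sub>R u) + f x = t * t * B z"
      using second_difference_mean_value[of x r f v t u] diff t unfolding B_def by (auto simp: add.commute)
    have "t * t * A y = t * t * B z"
      using y z by (simp add: algebra_simps)
    then have "A y = B z"
      using t by simp
    moreover have "dist y x < r1" "dist z x < r2"
      using y(1) z(1) by (auto simp: r_def dist_commute)
    then have "\<bar>A y - A x\<bar> < e/2" "\<bar>B z - B x\<bar> < e/2"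
      using r1(2) r2(2) by (auto simp: dist_real_def)
    ultimately show ?thesis
      by linarith
  qed
  then have "A x = B x"
    by (metis less_irrefl right_minus_eq zero_less_abs_iff)
  then show ?thesis
    by (simp add: A_def B_def)
qed

section \<open>Symmetry of second derivatives of vector-valued maps\<close>

lemma deriv_at_inner_const:
  assumes "f differentiable at x"
  shows "deriv_at (\<lambda>y. f y \<bullet> b) x v = deriv_at f x v \<bullet> b"
  using deriv_at_inner[OF assms differentiable_const[of b]] by simp

text \<open>Since \<open>S\<close> is open, agreement on \<open>S\<close> forces agreement of the
  derivatives on \<open>S\<close>, so the induction passes to them. This allows derivative formulas
  that hold only on \<open>S\<close> to be used inside \<open>C_k_on\<close>.\<close>

lemma C_k_on_cong:
  assumes "open S" "C_k_on k f S" "\<And>x. x \<in> S \<Longrightarrow> g x = f x"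
  shows "C_k_on k g S"
  using assms(2,3)
proof (induction k arbitrary: f g)
  case 0
  then show ?case by (auto cong: continuous_on_cong)
next
  case (Suc k)
  have "g differentiable at x" "deriv_at g x = deriv_at f x" if "x \<in> S" for x
  proof -
    have *: "(f has_derivative deriv_at f x) (at x)"
      using Suc.prems that by (simp add: frechet_derivative_works)
    have "(g has_derivative deriv_at f x) (at x)"
      by (rule has_derivative_transform_within_open[OF * assms(1) that]) (simp add: Suc.prems)
    then show "g differentiable at x" "deriv_at g x = deriv_at f x"
      by (rule differentiableI, rule frechet_derivative_at[symmetric])
  qed
  moreover have "C_k_on k (\<lambda>x. deriv_at g x v) S" for v
    by (rule Suc.IH[of "\<lambda>x. deriv_at f x v"]) (use Suc.prems(1) calculation(2) in auto)
  ultimately show ?case by simp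
qed

lemma smooth_on_inner_const:
  assumes "open S" "smooth_on S f"
  shows "smooth_on S (\<lambda>y. f y \<bullet> b)"
  unfolding smooth_on_def
proof
  fix k
  have "C_k_on k f S" using assms by (simp add: smooth_on_def)
  then show "C_k_on k (\<lambda>y. f y \<bullet> b) S"
  proof (induction k arbitrary: f)
    case 0
    then show ?case by (auto intro: continuous_intros)
  next
    case (Suc k)
    have "C_k_on k (\<lambda>y. deriv_at f y v \<bullet> b) S" for v
      by (rule Suc.IH) (use Suc.prems in simp)
    then have "C_k_on k (\<lambda>y. deriv_at (\<lambda>y. f y \<bullet> b) y v) S" for v
      by (rule C_k_on_cong[OF assms(1)]) (use Suc.prems in \<open>simp add: deriv_at_inner_const\<close>)
    then show ?case
      using Suc.prems by simp
  qed
qed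

text \<open>Taking the component along a basis vector commutes with both differentiations, which
  reduces the claim to the real-valued case.\<close>

lemma second_derivative_symmetric:
  assumes S: "open S" "x \<in> S" and f: "smooth_on S f"
  shows "deriv_at (\<lambda>y. deriv_at f y u) x v = deriv_at (\<lambda>y. deriv_at f y v) x u"
proof (rule euclidean_eqI)
  fix b :: 'b assume "b \<in> Basis"
  have *: "deriv_at (\<lambda>y. deriv_at (\<lambda>y. f y \<bullet> b) y u) x v = deriv_at (\<lambda>y. deriv_at f y u) x v \<bullet> b" for u v
  proof -
    have "deriv_at (\<lambda>y. deriv_at f y u \<bullet> b) x v = deriv_at (\<lambda>y. deriv_at (\<lambda>y. f y \<bullet> b) y u) x v"
      using S f
      by (subst frechet_derivative_transform_within_open[where X = S and g = "\<lambda>y. deriv_at (\<lambda>y. f y \<bullet> b) y u"])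
        (auto simp: deriv_at_inner_const smooth_on_differentiable[OF smooth_on_deriv_at] smooth_on_differentiable)
    then show ?thesis
      using deriv_at_inner_const[OF smooth_on_differentiable[OF smooth_on_deriv_at[OF f] S(2)]] by metis
  qed
  show "deriv_at (\<lambda>y. deriv_at f y u) x v \<bullet> b = deriv_at (\<lambda>y. deriv_at f y v) x u \<bullet> b"
    using second_derivative_symmetric_real[OF S smooth_on_inner_const[OF S(1) f], of b u v]
    by (simp add: *)
qed

section \<open>Differentiability of solutions of linear systems\<close>

lemma differentiable_det:
  fixes A :: "'a::euclidean_space \<Rightarrow> real ^ 'n ^ 'n"
  assumes "\<And>i j. (\<lambda>y. A y $ i $ j) differentiable at x"
  shows "(\<lambda>y. det (A y)) differentiable at x"
proof -
  have prod: "(\<lambda>y. \<Prod>i\<in>I. f i y) differentiable at x"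
    if "\<And>i. (f i) differentiable at x" for I :: "'n set" and f :: "'n \<Rightarrow> 'a \<Rightarrow> real"
    using that by (induction I rule: infinite_finite_induct) auto
  show ?thesis
    unfolding det_def by (intro differentiable_sum differentiable_mult differentiable_const prod assms ballI) auto
qed

text \<open>By Cramer's rule \<open>w\<close> agrees on \<open>S\<close> with quotients of
  determinants in the entries of \<open>A\<close> and \<open>b\<close>. This serves for maps known
  only through the equations they solve, as \<open>christoffel\<close> is.\<close>

lemma differentiable_linear_solution:
  fixes A :: "'a::euclidean_space \<Rightarrow> real ^ 'n ^ 'n" and b w :: "'a \<Rightarrow> real ^ 'n"
  assumes S: "open S" "x \<in> S"
    and A: "\<And>i j. (\<lambda>y. A y $ i $ j) differentiable at x"
    and b: "\<And>i. (\<lambda>y. b y $ i) differentiable at x"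
    and det: "\<And>y. y \<in> S \<Longrightarrow> det (A y) \<noteq> 0"
    and w: "\<And>y. y \<in> S \<Longrightarrow> A y *v w y = b y"
  shows "w differentiable at x"
proof -
  define c where "c = (\<lambda>y. \<chi> k. det (\<chi> i j. if j = k then b y $ i else A y $ i $ j) / det (A y))"
  have "(\<lambda>y. c y $ k) differentiable at x" for k
    unfolding c_def vec_lambda_beta
  proof (intro differentiable_divide differentiable_det)
    show "(\<lambda>y. (\<chi> i j. if j = k then b y $ i else A y $ i $ j) $ i $ j) differentiable at x" for i j
      using A b by (cases "j = k") auto
  qed (use A det S in auto)
  then have "(\<lambda>y. c y \<bullet> i) differentiable at x" if "i \<in> Basis" for i
    using that by (auto simp: Basis_vec_def inner_axis)
  then have "c differentiable at x"
    using differentiable_componentwise_within by blast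
  then obtain c' where "(c has_derivative c') (at x)"
    by (auto simp: differentiable_def)
  then have "(w has_derivative c') (at x)"
    by (rule has_derivative_transform_within_open[OF _ S]) (use w det in \<open>simp add: cramer c_def\<close>)
  then show ?thesis
    by (auto simp: differentiable_def)
qed


section \<open>The Gauss equation\<close>

text \<open>An isometric immersion read in one chart. \<open>G\<close> is tied to \<open>F\<close>
  on \<open>S\<close> only, so identities for its derivatives rest on \<open>S\<close> being
  open.\<close>

locale euclidean_immersion =
  fixes S :: "(real ^ 'n::finite) set" and F :: "real ^ 'n \<Rightarrow> 'b::euclidean_space"
    and G :: "real ^ 'n \<Rightarrow> real ^ 'n \<Rightarrow> real ^ 'n \<Rightarrow> real"
  assumes open_S: "open S" and smooth_F: "smooth_on S F"
    and inj_dF: "x \<in> S \<Longrightarrow> inj (deriv_at F x)"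
    and G_eq: "x \<in> S \<Longrightarrow> G x u v = deriv_at F x u \<bullet> deriv_at F x v"
begin

abbreviation d2F :: "real ^ 'n \<Rightarrow> real ^ 'n \<Rightarrow> real ^ 'n \<Rightarrow> 'b" where
  "d2F x u v \<equiv> deriv_at (\<lambda>y. deriv_at F y v) x u"

text \<open>By the Gauss formula the tangential part of the second derivative is the image of
  \<open>christoffel\<close>, so this is its normal component. Writing it with
  \<open>christoffel\<close> instead of a projection lets it be substituted directly in curvature
  computations.\<close>

definition sff :: "real ^ 'n \<Rightarrow> real ^ 'n \<Rightarrow> real ^ 'n \<Rightarrow> 'b" where
  "sff x u v = d2F x u v - deriv_at F x (christoffel G x u v)"

lemma linear_dF: "x \<in> S \<Longrightarrow> linear (deriv_at F x)"
  by (rule linear_deriv_at[OF smooth_F])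

lemma smooth_dF: "smooth_on S (\<lambda>x. deriv_at F x v)"
  by (rule smooth_on_deriv_at[OF smooth_F])

lemma smooth_d2F: "smooth_on S (\<lambda>x. d2F x u v)"
  by (rule smooth_on_deriv_at[OF smooth_dF])

lemma differentiable_dF: "x \<in> S \<Longrightarrow> (\<lambda>x. deriv_at F x v) differentiable at x"
  by (rule smooth_on_differentiable[OF smooth_dF])

lemma differentiable_d2F: "x \<in> S \<Longrightarrow> (\<lambda>x. d2F x u v) differentiable at x"
  by (rule smooth_on_differentiable[OF smooth_d2F])

lemma d2F_commute: "x \<in> S \<Longrightarrow> d2F x u v = d2F x v u"
  by (rule second_derivative_symmetric[OF open_S _ smooth_F])

lemma linear_d2F: "x \<in> S \<Longrightarrow> linear (\<lambda>u. d2F x u v)"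
  by (rule linear_deriv_at[OF smooth_dF])

lemma linear_d2F_right:
  assumes "x \<in> S"
  shows "linear (d2F x u)"
proof -
  have "d2F x u = (\<lambda>v. d2F x v u)"
    using d2F_commute[OF assms] by auto
  then show ?thesis
    using linear_d2F[OF assms] by simp
qed

lemma deriv_at_G:
  assumes "x \<in> S"
  shows "deriv_at (\<lambda>y. G y v z) x u = deriv_at F x v \<bullet> d2F x u z + d2F x u v \<bullet> deriv_at F x z"
proof -
  have "deriv_at (\<lambda>y. G y v z) x = deriv_at (\<lambda>y. deriv_at F y v \<bullet> deriv_at F y z) x"
    by (rule frechet_derivative_transform_within_open[OF _ open_S assms, symmetric])
      (simp_all add: G_eq differentiable_dF assms)
  then show ?thesis
    by (simp add: deriv_at_inner differentiable_dF assms)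
qed

lemma G_nondegenerate:
  assumes "x \<in> S" "\<And>z. G x w z = G x w' z"
  shows "w = w'"
proof -
  interpret linear "deriv_at F x" by (rule linear_dF[OF assms(1)])
  have "deriv_at F x (w - w') \<bullet> deriv_at F x (w - w') = 0"
    using assms(2)[of "w - w'"] assms(1) by (simp add: G_eq diff inner_diff_left)
  then show ?thesis
    using inj_dF[OF assms(1)] by (simp add: diff inj_eq)
qed

text \<open>The solution is the preimage of the component of \<open>y\<close> in the range of the
  differential; the other component is orthogonal to that range. It supplies the existence part of
  the description defining \<open>christoffel\<close>.\<close>

lemma tangent_projection:
  assumes "x \<in> S"
  shows "\<exists>w. \<forall>z. deriv_at F x w \<bullet> deriv_at F x z = y \<bullet> deriv_at F x z"
proof -
  have range: "span (range (deriv_at F x)) = range (deriv_at F x)"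
    using linear_dF[OF assms] by (simp add: linear_subspace_image)
  obtain a b where "a \<in> span (range (deriv_at F x))"
    "\<And>w. w \<in> span (range (deriv_at F x)) \<Longrightarrow> orthogonal b w" "y = a + b"
    using orthogonal_subspace_decomp_exists[of "range (deriv_at F x)" y] by blast
  then show ?thesis
    unfolding range by (auto simp: orthogonal_def inner_add_left)
qed

text \<open>Expanding the three derivatives of \<open>G\<close> in the Koszul formula by the product
  rule, symmetry of \<open>d2F\<close> cancels everything except twice the right side. Hence the
  tangential projection of \<open>d2F x u v\<close> satisfies the defining identity, and
  \<open>G_nondegenerate\<close> makes it the only solution.\<close>

lemma christoffel:
  assumes x: "x \<in> S"
  shows "deriv_at F x (christoffel G x u v) \<bullet> deriv_at F x z = d2F x u v \<bullet> deriv_at F x z"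
proof -
  obtain w where w: "\<And>z. deriv_at F x w \<bullet> deriv_at F x z = d2F x u v \<bullet> deriv_at F x z"
    using tangent_projection[OF x] by blast
  have koszul: "deriv_at (\<lambda>y. G y v z) x u + deriv_at (\<lambda>y. G y u z) x v - deriv_at (\<lambda>y. G y u v) x z
      = 2 * (d2F x u v \<bullet> deriv_at F x z)" for z
    using x by (simp add: deriv_at_G d2F_commute[of x v u] d2F_commute[of x z] inner_commute)
  have "christoffel G x u v = w"
    unfolding christoffel_def koszul
  proof (rule the_equality)
    show "\<forall>z. 2 * G x w z = 2 * (d2F x u v \<bullet> deriv_at F x z)"
      using x by (simp add: G_eq w)
    show "w' = w" if "\<forall>z. 2 * G x w' z = 2 * (d2F x u v \<bullet> deriv_at F x z)" for w'
      by (rule G_nondegenerate[OF x]) (use that x w in \<open>simp add: G_eq\<close>)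
  qed
  with w show ?thesis by simp
qed

lemma sff_normal: "x \<in> S \<Longrightarrow> sff x u v \<bullet> deriv_at F x z = 0"
  by (simp add: sff_def inner_diff_left christoffel)

text \<open>A vector both tangent and normal is orthogonal to itself. This transfers symmetry and
  linearity from \<open>d2F\<close> to \<open>sff\<close> without proving them for
  \<open>christoffel\<close> first: the defect of each law is tangent as an image of
  \<open>christoffel\<close> terms, and normal as a combination of values of
  \<open>sff\<close>.\<close>

lemma tangent_normal_zero:
  assumes "x \<in> S" "y = deriv_at F x w" "\<And>z. y \<bullet> deriv_at F x z = 0"
  shows "y = 0"
  using assms(2) assms(3)[of w] by simp

lemma sff_commute:
  assumes "x \<in> S"
  shows "sff x u v = sff x v u"
proof -
  have "sff x u v - sff x v u = 0"
    using assms by (intro tangent_normal_zero[OF assms, of _ "christoffel G x v u - christoffel G x u v"])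
      (simp_all add: christoffel inner_diff_left sff_def d2F_commute[of x u v] linear_diff[OF linear_dF])
  then show ?thesis by simp
qed

lemma linear_sff_left:
  assumes x: "x \<in> S"
  shows "linear (\<lambda>u. sff x u v)"
proof
  fix a b :: "real ^ 'n" and r :: real
  have "sff x (a + b) v - (sff x a v + sff x b v) = 0"
    using x by (intro tangent_normal_zero[OF x, of _
        "christoffel G x a v + christoffel G x b v - christoffel G x (a + b) v"])
      (simp_all add: christoffel inner_diff_left inner_add_left sff_def linear_diff[OF linear_dF]
        linear_add[OF linear_dF] linear_add[OF linear_d2F])
  then show "sff x (a + b) v = sff x a v + sff x b v" by simp
  have "sff x (r *\<^sub>R a) v - r *\<^sub>R sff x a v = 0"
    using x by (intro tangent_normal_zero[OF x, of _
        "r *\<^sub>R christoffel G x a v - christoffel G x (r *\<^sub>R a) v"])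
      (simp_all add: christoffel inner_diff_left sff_def linear_diff[OF linear_dF]
        linear_cmul[OF linear_dF] linear_cmul[OF linear_d2F] scaleR_diff_right)
  then show "sff x (r *\<^sub>R a) v = r *\<^sub>R sff x a v" by simp
qed

lemma bilinear_sff: "x \<in> S \<Longrightarrow> bilinear (sff x)"
  unfolding bilinear_def using linear_sff_left sff_commute by (metis (no_types, lifting) ext)

text \<open>Tested on the coordinate vectors, the lemma \<open>christoffel\<close> is a linear
  system whose matrix is the Gram matrix of the differential. A vector \<open>w\<close> in the
  kernel of that matrix satisfies \<open>deriv_at F y w = 0\<close>, so injectivity makes the
  determinant nonzero.\<close>

lemma differentiable_christoffel:
  assumes x: "x \<in> S"
  shows "(\<lambda>y. christoffel G y u v) differentiable at x"
proof (rule differentiable_linear_solution[OF open_S x])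
  let ?A = "\<lambda>y. \<chi> i j. deriv_at F y (axis i 1) \<bullet> deriv_at F y (axis j 1)"
  show "(\<lambda>y. ?A y $ i $ j) differentiable at x" for i j
    using x by (simp add: differentiable_dF)
  show "(\<lambda>y. (\<chi> i. d2F y u v \<bullet> deriv_at F y (axis i 1)) $ i) differentiable at x" for i
    using x by (simp add: differentiable_dF differentiable_d2F)
  have A: "?A y *v w = (\<chi> i. deriv_at F y w \<bullet> deriv_at F y (axis i 1))" if "y \<in> S" for y w
  proof -
    interpret linear "deriv_at F y" by (rule linear_dF[OF that])
    have "deriv_at F y w = (\<Sum>j\<in>UNIV. w $ j *\<^sub>R deriv_at F y (axis j 1))"
      by (subst basis_expansion[symmetric]) (simp add: sum scale scalar_mult_eq_scaleR)
    then show ?thesis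
      by (simp add: matrix_vector_mult_def vec_eq_iff inner_sum_left inner_sum_right inner_commute mult.commute)
  qed
  show "?A y *v christoffel G y u v = (\<chi> i. d2F y u v \<bullet> deriv_at F y (axis i 1))" if "y \<in> S" for y
    using that by (simp add: A christoffel)
  show "det (?A y) \<noteq> 0" if y: "y \<in> S" for y
  proof -
    interpret linear "deriv_at F y" by (rule linear_dF[OF y])
    have "w = 0" if "?A y *v w = 0" for w
    proof -
      have "deriv_at F y w \<bullet> deriv_at F y (axis i 1) = 0" for i
        using that A[OF y, of w] by (simp add: vec_eq_iff)
      then have "deriv_at F y w \<bullet> (\<Sum>j\<in>UNIV. w $ j *\<^sub>R deriv_at F y (axis j 1)) = 0"
        by (simp add: inner_sum_right)
      also have "(\<Sum>j\<in>UNIV. w $ j *\<^sub>R deriv_at F y (axis j 1)) = deriv_at F y w"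
        by (subst (2) basis_expansion[symmetric]) (simp add: sum scale scalar_mult_eq_scaleR)
      finally show "w = 0"
        using inj_dF[OF y] by (metis inner_eq_zero_iff injD zero)
    qed
    then have "invertible (?A y)"
      by (simp add: invertible_left_inverse matrix_left_invertible_ker)
    then show ?thesis
      by (simp add: invertible_det_nz)
  qed
qed

section \<open>Covariant derivatives and curvature of the induced metric\<close>

lemma levi_civita_const: "levi_civita G (\<lambda>_. v) (\<lambda>_. w) = (\<lambda>y. christoffel G y v w)"
  by (simp add: levi_civita_def fun_eq_iff)

text \<open>Differentiate \<open>dF \<Gamma>(v,w) \<cdot> dF z = d\<^sup>2F(v,w) \<cdot> dF z\<close> in the direction \<open>u\<close>.\<close>

lemma second_covariant_derivative:
  assumes x: "x \<in> S"
  shows "G x (levi_civita G (\<lambda>_. u) (levi_civita G (\<lambda>_. v) (\<lambda>_. w)) x) z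
    = deriv_at (\<lambda>y. d2F y v w) x u \<bullet> deriv_at F x z + sff x v w \<bullet> sff x u z"
proof -
  let ?\<Gamma> = "\<lambda>y. christoffel G y v w"
  let ?c = "deriv_at ?\<Gamma> x u"
  interpret linear "deriv_at F x" by (rule linear_dF[OF x])
  have d\<Gamma>: "(?\<Gamma> has_derivative deriv_at ?\<Gamma> x) (at x)"
    using differentiable_christoffel[OF x] by (simp add: frechet_derivative_works)
  have dF: "((\<lambda>y. deriv_at F y b) has_derivative (\<lambda>u. d2F x u b)) (at x)" for b
    using differentiable_dF[OF x] by (simp add: frechet_derivative_works)
  \<comment> \<open>Both the base point and the argument of the differential vary with
    \<open>y\<close>. Expanding the argument over \<open>Basis\<close> turns this into a finite sum
    of products, to which the product rule applies.\<close>
  let ?P = "\<lambda>y. \<Sum>i\<in>Basis. (?\<Gamma> y \<bullet> i) *\<^sub>R deriv_at F y i"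
  have expand: "deriv_at F y b = (\<Sum>i\<in>Basis. (b \<bullet> i) *\<^sub>R deriv_at F y i)" if "y \<in> S" for y b
    using linear_sum[OF linear_dF[OF that], of "\<lambda>i. (b \<bullet> i) *\<^sub>R i" Basis]
    by (simp add: euclidean_representation linear_cmul[OF linear_dF[OF that]])
  have "(?P has_derivative (\<lambda>u. \<Sum>i\<in>Basis. (?\<Gamma> x \<bullet> i) *\<^sub>R d2F x u i + (deriv_at ?\<Gamma> x u \<bullet> i) *\<^sub>R deriv_at F x i)) (at x)"
    by (intro has_derivative_sum has_derivative_scaleR has_derivative_inner_left d\<Gamma> dF)
  moreover have "(\<Sum>i\<in>Basis. (?\<Gamma> x \<bullet> i) *\<^sub>R d2F x u i) = d2F x u (?\<Gamma> x)" for u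
    using linear_sum[OF linear_d2F_right[OF x, of u], of "\<lambda>i. (?\<Gamma> x \<bullet> i) *\<^sub>R i" Basis]
    by (simp add: euclidean_representation linear_cmul[OF linear_d2F_right[OF x]])
  ultimately have "(?P has_derivative (\<lambda>u. d2F x u (?\<Gamma> x) + deriv_at F x (deriv_at ?\<Gamma> x u))) (at x)"
    by (simp add: sum.distrib expand[OF x, symmetric])
  then have P: "((\<lambda>y. deriv_at F y (?\<Gamma> y)) has_derivative
      (\<lambda>u. d2F x u (?\<Gamma> x) + deriv_at F x (deriv_at ?\<Gamma> x u))) (at x)"
    by (rule has_derivative_transform_within_open[OF _ open_S x]) (simp add: expand)
  have d1: "(\<lambda>y. deriv_at F y (?\<Gamma> y)) differentiable at x"
    and d1': "deriv_at (\<lambda>y. deriv_at F y (?\<Gamma> y)) x u = d2F x u (?\<Gamma> x) + deriv_at F x ?c"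
    by (rule differentiableI[OF P]) (simp add: frechet_derivative_at[OF P, symmetric])
  \<comment> \<open>The identity of the lemma \<open>christoffel\<close> holds on the open set
    \<open>S\<close>, hence both sides may be differentiated at \<open>x\<close>.\<close>
  have "deriv_at (\<lambda>y. deriv_at F y (?\<Gamma> y) \<bullet> deriv_at F y z) x
      = deriv_at (\<lambda>y. d2F y v w \<bullet> deriv_at F y z) x"
    by (rule frechet_derivative_transform_within_open[OF _ open_S x])
      (simp_all add: d1 differentiable_dF x christoffel)
  then have "deriv_at F x (?\<Gamma> x) \<bullet> d2F x u z + (d2F x u (?\<Gamma> x) + deriv_at F x ?c) \<bullet> deriv_at F x z
      = d2F x v w \<bullet> d2F x u z + deriv_at (\<lambda>y. d2F y v w) x u \<bullet> deriv_at F x z"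
    using deriv_at_inner[OF d1 differentiable_dF[OF x, of z], of u]
      deriv_at_inner[OF differentiable_d2F[OF x, of w v] differentiable_dF[OF x, of z], of u]
    by (simp add: d1')
  \<comment> \<open>\<open>sff x v w\<close> is normal, so only the normal part of
    \<open>d2F x u z\<close> counts.\<close>
  moreover have "sff x v w \<bullet> d2F x u z = sff x v w \<bullet> sff x u z"
    using sff_normal[OF x] by (simp add: sff_def[of x u z] inner_diff_right)
  ultimately show ?thesis
    unfolding levi_civita_const G_eq[OF x] levi_civita_def[of G "\<lambda>_. u"] add
    by (simp add: inner_add_left christoffel[OF x] sff_def[of x v w] inner_diff_left)
qed

text \<open>The two iterated covariant derivatives contain third derivatives of \<open>F\<close>
  that differ only in the order of \<open>u\<close> and \<open>v\<close>. They cancel by symmetry,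
  leaving the products of \<open>sff\<close>.\<close>

lemma gauss_equation:
  assumes x: "x \<in> S"
  shows "G x (riemann_curvature G x u v w) z = sff x v w \<bullet> sff x u z - sff x u w \<bullet> sff x v z"
proof -
  have "deriv_at (\<lambda>y. d2F y v w) x u = deriv_at (\<lambda>y. d2F y u w) x v"
    by (rule second_derivative_symmetric[OF open_S x smooth_dF])
  moreover have "G x (a - b) z = G x a z - G x b z" for a b
    by (simp add: G_eq[OF x] linear_diff[OF linear_dF[OF x]] inner_diff_left)
  ultimately show ?thesis
    by (simp add: riemann_curvature_def second_covariant_derivative[OF x])
qed

end


section \<open>Orthonormal bases and curvature sums\<close>

definition orthonormal_wrt :: "('a \<Rightarrow> 'a \<Rightarrow> real) \<Rightarrow> 'a set \<Rightarrow> bool" where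
  "orthonormal_wrt g B \<longleftrightarrow> (\<forall>u\<in>B. \<forall>v\<in>B. g u v = (if u = v then 1 else 0))"

text \<open>The form \<open>g\<close> need not be the inner product of the type: orthonormality
  refers to \<open>g\<close>, while span, dimension and independence are the usual ones.\<close>

locale inner_form =
  fixes g :: "'a::euclidean_space \<Rightarrow> 'a \<Rightarrow> real"
  assumes bilin: "bilinear g" and sym: "g u v = g v u" and pos: "u \<noteq> 0 \<Longrightarrow> g u u > 0"
begin

lemmas g_simps = bilinear_ladd[OF bilin] bilinear_radd[OF bilin] bilinear_lsub[OF bilin] bilinear_rsub[OF bilin]
  bilinear_lmul[OF bilin] bilinear_rmul[OF bilin] bilinear_lzero[OF bilin] bilinear_rzero[OF bilin]

lemma linear_g: "linear (g u)" "linear (\<lambda>u. g u v)"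
  using bilin by (auto simp: bilinear_def)

lemma g_sum_left: "g (\<Sum>i\<in>I. f i) v = (\<Sum>i\<in>I. g (f i) v)"
  using linear_sum[OF linear_g(2)] by simp

lemma orthonormal_independent:
  assumes "orthonormal_wrt g B"
  shows "independent B"
  unfolding independent_explicit_module
proof (intro allI impI)
  fix T u v assume T: "finite T" "T \<subseteq> B" "(\<Sum>v\<in>T. u v *\<^sub>R v) = 0" "v \<in> T"
  have "0 = g (\<Sum>w\<in>T. u w *\<^sub>R w) v"
    by (simp add: T g_simps)
  also have "\<dots> = (\<Sum>w\<in>T. if w = v then u v else 0)"
    unfolding g_sum_left using T assms
    by (intro sum.cong) (auto simp: g_simps orthonormal_wrt_def subset_eq)
  also have "\<dots> = u v"
    using T by simp
  finally show "u v = 0" by simp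
qed

lemma orthonormal_finite: "orthonormal_wrt g B \<Longrightarrow> finite B"
  using orthonormal_independent independent_imp_finite by blast

lemma orthonormal_expansion:
  assumes B: "orthonormal_wrt g B" and v: "v \<in> span B"
  shows "v = (\<Sum>b\<in>B. g v b *\<^sub>R b)"
proof -
  obtain u where u: "v = (\<Sum>b\<in>B. u b *\<^sub>R b)"
    using v orthonormal_finite[OF B] by (auto simp: span_finite)
  have "g v b = u b" if "b \<in> B" for b
  proof -
    have "g v b = (\<Sum>w\<in>B. if w = b then u b else 0)"
      unfolding u g_sum_left using that B
      by (intro sum.cong) (auto simp: g_simps orthonormal_wrt_def)
    then show ?thesis using that orthonormal_finite[OF B] by simp
  qed
  then show ?thesis using u by (metis (no_types, lifting) sum.cong)
qed

text \<open>Take an orthonormal set of maximal cardinality between \<open>E\<close> and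
  \<open>T\<close>. If some \<open>x\<close> in \<open>T\<close> were outside its span, subtracting
  the projection of \<open>x\<close> and normalising would give a further orthonormal
  vector.\<close>

lemma orthonormal_extend:
  assumes E: "orthonormal_wrt g E" "E \<subseteq> T" and T: "subspace T"
  obtains B where "orthonormal_wrt g B" "E \<subseteq> B" "B \<subseteq> T" "span B = T"
proof -
  let ?P = "\<lambda>B. orthonormal_wrt g B \<and> E \<subseteq> B \<and> B \<subseteq> T"
  have "card B \<le> DIM('a)" if "?P B" for B
    using that orthonormal_independent independent_bound by blast
  then obtain B where B: "?P B" and max: "\<And>C. ?P C \<Longrightarrow> card C \<le> card B"
    using ex_has_greatest_nat[of ?P E card "DIM('a) + 1"] E by (force simp: less_Suc_eq_le)
  have fin: "finite B" using B orthonormal_finite by blast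
  have "T \<subseteq> span B"
  proof (rule ccontr)
    assume "\<not> T \<subseteq> span B"
    then obtain x where x: "x \<in> T" "x \<notin> span B" by blast
    define y where "y = x - (\<Sum>b\<in>B. g x b *\<^sub>R b)"
    have sum: "(\<Sum>b\<in>B. g x b *\<^sub>R b) \<in> span B"
      by (intro span_sum span_scale span_base)
    then have y: "y \<in> T" "y \<noteq> 0" "y \<notin> span B"
      using x B T span_minimal[of B T] span_add_eq[OF sum, of y] unfolding y_def
      by (auto intro: subspace_diff simp: subsetD)
    have yb: "g y b = 0" if "b \<in> B" for b
    proof -
      have "g (\<Sum>b\<in>B. g x b *\<^sub>R b) b = (\<Sum>c\<in>B. if c = b then g x b else 0)"
        unfolding g_sum_left using that B
        by (intro sum.cong) (auto simp: g_simps orthonormal_wrt_def)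
      then show ?thesis using that fin by (simp add: y_def g_simps)
    qed
    define z where "z = (1 / sqrt (g y y)) *\<^sub>R y"
    have gy: "g y y > 0" using pos y by blast
    have zz: "g z z = 1" using gy by (simp add: z_def g_simps)
    have zb: "g z b = 0" "g b z = 0" if "b \<in> B" for b
      using yb[OF that] sym[of b y] by (simp_all add: z_def g_simps)
    have "z \<notin> B" using zb zz by force
    moreover have "?P (insert z B)"
      using B zz zb \<open>z \<notin> B\<close> y T by (auto simp: orthonormal_wrt_def z_def subspace_scale)
    ultimately show False
      using max[of "insert z B"] fin by simp
  qed
  moreover have "span B \<subseteq> T" using B T by (simp add: span_minimal)
  ultimately show thesis using that B by blast
qed

text \<open>Expand the second argument in \<open>C\<close>, exchange the sums, and recombine the
  first argument from its expansion in \<open>B\<close>. This removes the dependence of Ricci and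
  mean curvature on the bases picked by \<open>SOME\<close>.\<close>

lemma trace_unique:
  fixes \<phi> :: "'a \<Rightarrow> 'a \<Rightarrow> 'b::real_vector"
  assumes \<phi>: "bilinear \<phi>" and B: "orthonormal_wrt g B" "span B = UNIV"
    and C: "orthonormal_wrt g C" "span C = UNIV"
  shows "(\<Sum>e\<in>B. \<phi> e e) = (\<Sum>c\<in>C. \<phi> c c)"
proof -
  have lin: "linear (\<phi> u)" "linear (\<lambda>u. \<phi> u v)" for u v
    using \<phi> by (auto simp: bilinear_def)
  have right: "\<phi> u v = (\<Sum>c\<in>C. g v c *\<^sub>R \<phi> u c)" for u v
    using linear_sum[OF lin(1)[of u], of "\<lambda>c. g v c *\<^sub>R c" C] orthonormal_expansion[OF C(1), of v] C(2)
    by (simp add: linear_cmul[OF lin(1)])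
  have left: "(\<Sum>e\<in>B. g c e *\<^sub>R \<phi> e c) = \<phi> c c" for c
    using linear_sum[OF lin(2)[of c], of "\<lambda>e. g c e *\<^sub>R e" B] orthonormal_expansion[OF B(1), of c] B(2)
    by (simp add: linear_cmul[OF lin(2)])
  have "(\<Sum>e\<in>B. \<phi> e e) = (\<Sum>e\<in>B. \<Sum>c\<in>C. g c e *\<^sub>R \<phi> e c)"
    by (subst right) (simp add: sym)
  also have "\<dots> = (\<Sum>c\<in>C. \<Sum>e\<in>B. g c e *\<^sub>R \<phi> e c)"
    by (rule sum.swap)
  finally show ?thesis by (simp add: left)
qed

lemma plane_orthonormal_basis:
  assumes "subspace \<pi>" "dim \<pi> = 2"
  obtains a b where "a \<noteq> b" "orthonormal_wrt g {a, b}" "span {a, b} = \<pi>"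
proof -
  obtain B where B: "orthonormal_wrt g B" "span B = \<pi>"
    using orthonormal_extend[of "{}" \<pi>] assms(1) by (metis empty_subsetI empty_iff orthonormal_wrt_def)
  have "card B = 2"
    using dim_span_eq_card_independent[OF orthonormal_independent[OF B(1)]] B(2) assms(2) by simp
  then obtain a b where "B = {a, b}" "a \<noteq> b"
    by (meson card_2_iff)
  then show thesis
    using that B by simp
qed

end

text \<open>The Gauss equation turns \<open>sff_curvature h u v\<close> into \<open>\<langle>R(u,v)v,u\<rangle>\<close>.\<close>

definition sff_curvature :: "('a \<Rightarrow> 'a \<Rightarrow> 'b::real_inner) \<Rightarrow> 'a \<Rightarrow> 'a \<Rightarrow> real" where
  "sff_curvature h u v = h u u \<bullet> h v v - h u v \<bullet> h u v"

lemma sff_curvature_commute: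
  assumes "\<And>u v. h u v = h v u"
  shows "sff_curvature h u v = sff_curvature h v u"
  by (simp add: sff_curvature_def assms[of u v] inner_commute)

text \<open>The expression is a quadratic form in the bivector of its two arguments, and that
  bivector is multiplied by the determinant of the change of basis.\<close>

lemma sff_curvature_change_basis:
  fixes h :: "'a::real_vector \<Rightarrow> 'a \<Rightarrow> 'b::real_inner"
  assumes h: "bilinear h" "\<And>u v. h u v = h v u"
  shows "sff_curvature h (\<alpha> *\<^sub>R a + \<beta> *\<^sub>R b) (\<gamma> *\<^sub>R a + \<delta> *\<^sub>R b) = (\<alpha> * \<delta> - \<beta> * \<gamma>)\<^sup>2 * sff_curvature h a b"
  unfolding sff_curvature_def bilinear_ladd[OF h(1)] bilinear_radd[OF h(1)] bilinear_lmul[OF h(1)]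
    bilinear_rmul[OF h(1)] h(2)[of b a] inner_add_left inner_add_right inner_scaleR_left inner_scaleR_right
    inner_commute[of "h b b" "h a a"] inner_commute[of "h a b" "h a a"] inner_commute[of "h b b" "h a b"]
  by algebra

text \<open>Numerator and denominator both acquire the square of the determinant expressing
  \<open>u, v\<close> in \<open>a, b\<close>, and the denominator for the orthonormal pair is
  1.\<close>

lemma (in inner_form) curvature_quotient:
  fixes h :: "'a \<Rightarrow> 'a \<Rightarrow> 'b::real_inner"
  assumes h: "bilinear h" "\<And>u v. h u v = h v u"
    and ab: "a \<noteq> b" "orthonormal_wrt g {a, b}"
    and uv: "u \<noteq> v" "independent {u, v}" "span {u, v} = span {a, b}"
  shows "sff_curvature h u v / (g u u * g v v - (g u v)\<^sup>2) = sff_curvature h a b"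
proof -
  have "u \<in> span {a, b}"
    using span_base[of u "{u, v}"] uv(3) by simp
  then obtain \<alpha> \<beta> where u: "u = \<alpha> *\<^sub>R a + \<beta> *\<^sub>R b"
    by (auto simp: span_insert algebra_simps)
  have "v \<in> span {a, b}"
    using span_base[of v "{u, v}"] uv(3) by simp
  then obtain \<gamma> \<delta> where v: "v = \<gamma> *\<^sub>R a + \<delta> *\<^sub>R b"
    by (auto simp: span_insert algebra_simps)
  have ab1: "g a a = 1" "g b b = 1" "g a b = 0" "g b a = 0"
    using ab by (auto simp: orthonormal_wrt_def)
  have "\<alpha> * \<delta> - \<beta> * \<gamma> \<noteq> 0"
  proof
    assume det: "\<alpha> * \<delta> - \<beta> * \<gamma> = 0"
    have dep: "c = 0 \<and> d = 0" if "c *\<^sub>R u + d *\<^sub>R v = 0" for c d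
      using that uv independent_explicit[of "{u, v}"]
      by (auto dest!: spec[of _ "\<lambda>w. if w = u then c else d"])
    \<comment> \<open>The adjugate matrix gives two combinations of \<open>u\<close> and
      \<open>v\<close> that vanish with the determinant; independence then kills their coefficients,
      so \<open>u\<close> would be zero.\<close>
    have "\<delta> *\<^sub>R u + (- \<beta>) *\<^sub>R v = (\<alpha> * \<delta> - \<beta> * \<gamma>) *\<^sub>R a"
      by (simp add: u v algebra_simps)
    moreover have "\<gamma> *\<^sub>R u + (- \<alpha>) *\<^sub>R v = - (\<alpha> * \<delta> - \<beta> * \<gamma>) *\<^sub>R b"
      by (simp add: u v algebra_simps)
    ultimately have "\<alpha> = 0" "\<beta> = 0"
      using det dep[of \<delta> "- \<beta>"] dep[of \<gamma> "- \<alpha>"] by auto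
    then show False
      using dep[of 1 0] u by simp
  qed
  moreover have "g u u * g v v - (g u v)\<^sup>2 = (\<alpha> * \<delta> - \<beta> * \<gamma>)\<^sup>2"
    unfolding u v by (simp add: g_simps ab1) algebra
  ultimately show ?thesis
    using sff_curvature_change_basis[OF h, of \<alpha> a \<beta> b \<gamma> \<delta>] u v by simp
qed

section \<open>Cauchy-Schwarz over blocks of basis vectors\<close>

lemma norm_sum_squared_le:
  fixes f :: "'i \<Rightarrow> 'b::real_inner"
  shows "(norm (\<Sum>i\<in>I. f i))\<^sup>2 \<le> real (card I) * (\<Sum>i\<in>I. (norm (f i))\<^sup>2)"
proof -
  have "(norm (\<Sum>i\<in>I. f i))\<^sup>2 \<le> (\<Sum>i\<in>I. norm (f i))\<^sup>2"
    by (intro power_mono norm_sum) auto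
  also have "\<dots> \<le> (\<Sum>i\<in>I. (norm (f i))\<^sup>2) * (\<Sum>i\<in>I. 1\<^sup>2)"
    using Cauchy_Schwarz_ineq_sum[of "\<lambda>i. norm (f i)" "\<lambda>_. 1" I] by simp
  finally show ?thesis by (simp add: mult.commute)
qed

text \<open>Only pairs from different blocks contribute, and the part \<open>\<langle>h(e,e), h(e',e')\<rangle>\<close> of their
  curvature sums up to products of block traces; Cauchy--Schwarz over the blocks does the rest.\<close>

lemma block_curvature_bound:
  fixes h :: "'a \<Rightarrow> 'a \<Rightarrow> 'b::real_inner"
  assumes P: "finite P" "\<And>A. A \<in> P \<Longrightarrow> finite A" "\<And>A A'. A \<in> P \<Longrightarrow> A' \<in> P \<Longrightarrow> A \<noteq> A' \<Longrightarrow> A \<inter> A' = {}"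
    and ne: "P \<noteq> {}"
  shows "(\<Sum>e\<in>\<Union>P. \<Sum>e'\<in>\<Union>P. sff_curvature h e e') - (\<Sum>A\<in>P. \<Sum>e\<in>A. \<Sum>e'\<in>A. sff_curvature h e e')
    \<le> (1 - 1 / real (card P)) * (norm (\<Sum>e\<in>\<Union>P. h e e))\<^sup>2"
proof -
  define T where "T A A' = (\<Sum>e\<in>A. \<Sum>e'\<in>A'. sff_curvature h e e')" for A A'
  define s where "s A = (\<Sum>e\<in>A. h e e)" for A
  have union: "(\<Sum>e\<in>\<Union>P. f e) = (\<Sum>A\<in>P. \<Sum>e\<in>A. f e)" for f :: "'a \<Rightarrow> 'c::comm_monoid_add"
    by (subst sum.Union_disjoint) (use P in auto)
  have T_le: "T A A' \<le> s A \<bullet> s A'" for A A'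
    unfolding T_def s_def inner_sum_left inner_sum_right
    by (subst sum.swap, intro sum_mono) (simp add: sff_curvature_def)
  have "(\<Sum>e\<in>\<Union>P. \<Sum>e'\<in>\<Union>P. sff_curvature h e e') = (\<Sum>A\<in>P. \<Sum>A'\<in>P. T A A')"
    unfolding union T_def by (intro sum.cong refl) (rule sum.swap)
  also have "\<dots> - (\<Sum>A\<in>P. T A A) = (\<Sum>A\<in>P. \<Sum>A'\<in>P - {A}. T A A')"
    using P(1) by (simp add: sum_subtractf[symmetric] sum_diff1)
  \<comment> \<open>Only products of different blocks are estimated; the diagonal ones have been
    cancelled exactly.\<close>
  also have "\<dots> \<le> (\<Sum>A\<in>P. \<Sum>A'\<in>P - {A}. s A \<bullet> s A')"
    by (intro sum_mono T_le)
  also have "\<dots> = (\<Sum>A\<in>P. \<Sum>A'\<in>P. s A \<bullet> s A') - (\<Sum>A\<in>P. s A \<bullet> s A)"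
    using P(1) by (simp add: sum_subtractf[symmetric] sum_diff1)
  also have "(\<Sum>A\<in>P. \<Sum>A'\<in>P. s A \<bullet> s A') = (norm (\<Sum>A\<in>P. s A))\<^sup>2"
    unfolding power2_norm_eq_inner inner_sum_left inner_sum_right by (rule sum.swap)
  also have "(norm (\<Sum>A\<in>P. s A))\<^sup>2 - (\<Sum>A\<in>P. s A \<bullet> s A) \<le> (1 - 1 / real (card P)) * (norm (\<Sum>A\<in>P. s A))\<^sup>2"
  proof -
    have "card P > 0" using P ne by (simp add: card_gt_0_iff)
    then have "(norm (\<Sum>A\<in>P. s A))\<^sup>2 / real (card P) \<le> (\<Sum>A\<in>P. s A \<bullet> s A)"
      using norm_sum_squared_le[of s P] by (simp add: divide_le_eq mult.commute power2_norm_eq_inner)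
    then show ?thesis by (simp add: algebra_simps)
  qed
  finally show ?thesis
    by (simp add: union T_def s_def)
qed

text \<open>The blocks are the \<open>q\<close> pairs and the \<open>card B - 2 * q\<close> leftover
  singletons. A vector has curvature zero with itself, so singletons contribute nothing and each
  pair contributes its mixed term twice.\<close>

lemma paired_curvature_bound:
  fixes h :: "'a \<Rightarrow> 'a \<Rightarrow> 'b::real_inner" and a b :: "nat \<Rightarrow> 'a"
  assumes h: "\<And>u v. h u v = h v u"
    and B: "finite B" "\<And>i. i < q \<Longrightarrow> a i \<in> B" "\<And>i. i < q \<Longrightarrow> b i \<in> B"
    and ab: "\<And>i. i < q \<Longrightarrow> a i \<noteq> b i"
    and disj: "\<And>i j. i < q \<Longrightarrow> j < q \<Longrightarrow> i \<noteq> j \<Longrightarrow> {a i, b i} \<inter> {a j, b j} = {}"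
    and q: "q > 0"
  shows "(\<Sum>e\<in>B. \<Sum>e'\<in>B. sff_curvature h e e') - 2 * (\<Sum>i<q. sff_curvature h (a i) (b i))
    \<le> (1 - 1 / (real (card B) - real q)) * (norm (\<Sum>e\<in>B. h e e))\<^sup>2"
proof -
  let ?A = "\<lambda>i. {a i, b i}"
  define R where "R = B - (\<Union>i<q. ?A i)"
  define P where "P = ?A ` {..<q} \<union> (\<lambda>e. {e}) ` R"
  have inj: "inj_on ?A {..<q}"
    using disj by (force simp: inj_on_def)
  have sep: "?A ` {..<q} \<inter> (\<lambda>e. {e}) ` R = {}"
    by (auto simp: R_def)
  have finR: "finite R" using B by (simp add: R_def)
  have UP: "\<Union>P = B" using B by (auto simp: P_def R_def)
  have "card (\<Union>i<q. ?A i) = (\<Sum>i<q. card (?A i))"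
    using disj by (intro card_UN_disjoint) auto
  also have "\<dots> = (\<Sum>i<q. 2)"
    using ab by (intro sum.cong) auto
  finally have U: "card (\<Union>i<q. ?A i) = 2 * q" by simp
  have sub: "(\<Union>i<q. ?A i) \<subseteq> B" using B by auto
  \<comment> \<open>This makes the natural-number subtraction in the cardinality of \<open>R\<close>
    exact.\<close>
  have "2 * q \<le> card B"
    using card_mono[OF B(1) sub] U by simp
  moreover have "card R = card B - 2 * q"
    unfolding R_def using card_Diff_subset[OF _ sub] U by simp
  moreover have "card P = q + card R"
    unfolding P_def using finR inj sep by (subst card_Un_disjoint) (auto simp: card_image)
  ultimately have card_P: "real (card P) = real (card B) - real q"
    by simp
  have "(\<Sum>A\<in>P. \<Sum>e\<in>A. \<Sum>e'\<in>A. sff_curvature h e e')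
      = (\<Sum>i<q. \<Sum>e\<in>?A i. \<Sum>e'\<in>?A i. sff_curvature h e e') + (\<Sum>e\<in>R. sff_curvature h e e)"
    unfolding P_def using finR sep
    by (subst sum.union_disjoint) (auto simp: sum.reindex[OF inj] sum.reindex)
  also have "(\<Sum>e\<in>R. sff_curvature h e e) = 0"
    by (simp add: sff_curvature_def)
  also have "(\<Sum>i<q. \<Sum>e\<in>?A i. \<Sum>e'\<in>?A i. sff_curvature h e e') = (\<Sum>i<q. 2 * sff_curvature h (a i) (b i))"
  proof (rule sum.cong)
    fix i assume "i \<in> {..<q}"
    then show "(\<Sum>e\<in>?A i. \<Sum>e'\<in>?A i. sff_curvature h e e') = 2 * sff_curvature h (a i) (b i)"
      using ab[of i] sff_curvature_commute[of h, OF h, of "b i" "a i"]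
      by (simp add: sff_curvature_def[of h "a i" "a i"] sff_curvature_def[of h "b i" "b i"])
  qed simp
  finally have diag: "(\<Sum>A\<in>P. \<Sum>e\<in>A. \<Sum>e'\<in>A. sff_curvature h e e') = 2 * (\<Sum>i<q. sff_curvature h (a i) (b i))"
    by (simp add: sum_distrib_left)
  have "A \<inter> A' = {}" if "A \<in> P" "A' \<in> P" "A \<noteq> A'" for A A'
    using that disj unfolding P_def R_def by blast
  moreover have "finite P" "\<And>A. A \<in> P \<Longrightarrow> finite A" "P \<noteq> {}"
    using finR q by (auto simp: P_def)
  ultimately show ?thesis
    using block_curvature_bound[of P h] by (simp add: UP diag card_P)
qed


section \<open>Chen's inequality\<close>

locale immersed_point =
  fixes M :: "('m, 'n::finite) riemannian_data" and f :: "'m \<Rightarrow> complex ^ 'k::finite" and p :: 'm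
  assumes manifold: "riemannian_manifold M" and immersion: "isometric_immersion M f"
    and p: "p \<in> points M"
begin

abbreviation "patch \<equiv> coord (chart_at M p) ` cdom (chart_at M p)"
abbreviation "h \<equiv> second_fundamental_form M f p"

lemma chart_at: "chart_at M p \<in> atlas M" "p \<in> cdom (chart_at M p)"
proof -
  have "(\<Union>c\<in>atlas M. cdom c) = points M"
    using manifold by (auto simp: riemannian_manifold_def smooth_manifold_def)
  then have "\<exists>c. c \<in> atlas M \<and> p \<in> cdom c"
    using p by blast
  then show "chart_at M p \<in> atlas M" "p \<in> cdom (chart_at M p)"
    unfolding chart_at_def by (metis (mono_tags, lifting) someI_ex)+
qed

lemma point_at: "point_at M p \<in> patch"
  using chart_at by (simp add: point_at_def)

sublocale euclidean_immersion patch "in_chart f (chart_at M p)" "local_metric M p"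
proof
  show "open patch"
    using manifold chart_at(1) by (auto simp: riemannian_manifold_def smooth_manifold_def)
  show "smooth_on patch (in_chart f (chart_at M p))"
    using immersion chart_at(1) by (auto simp: isometric_immersion_def)
  show "inj (deriv_at (in_chart f (chart_at M p)) x)" if "x \<in> patch" for x
    using immersion chart_at(1) that by (auto simp: isometric_immersion_def Let_def)
  show "local_metric M p x u v
      = deriv_at (in_chart f (chart_at M p)) x u \<bullet> deriv_at (in_chart f (chart_at M p)) x v"
    if "x \<in> patch" for x u v
    using immersion chart_at(1) that by (auto simp: isometric_immersion_def Let_def local_metric_def)
qed

sublocale inner_form "tangent_inner M p"
proof -
  have "\<forall>x\<in>patch. bilinear (metric M (chart_at M p) x) \<and>
        (\<forall>u v. metric M (chart_at M p) x u v = metric M (chart_at M p) x v u) \<and>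
        (\<forall>u. u \<noteq> 0 \<longrightarrow> metric M (chart_at M p) x u u > 0)"
    using manifold chart_at(1) unfolding riemannian_manifold_def riemannian_metric_def by blast
  then show "inner_form (tangent_inner M p)"
    using point_at unfolding tangent_inner_def local_metric_def by unfold_locales blast+
qed

text \<open>\<open>sff\<close> meets the description, because what it removes from the second
  derivative is an image of the differential. Any other candidate differs from it by a vector both
  tangent and normal.\<close>

lemma second_fundamental_form_eq: "h u v = sff (point_at M p) u v"
proof -
  let ?D = "deriv_at (in_chart f (chart_at M p)) (point_at M p)"
  let ?w = "d2F (point_at M p) u v"
  have "(THE z. z \<in> normal_space M f p \<and> ?w - z \<in> tangent_image M f p) = sff (point_at M p) u v"
  proof (rule the_equality)
    show "sff (point_at M p) u v \<in> normal_space M f p \<and> ?w - sff (point_at M p) u v \<in> tangent_image M f p"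
      using sff_normal[OF point_at] unfolding normal_space_def tangent_image_def pushforward_def
      by (auto simp: orthogonal_comp_def orthogonal_def sff_def inner_commute)
  next
    fix z assume z: "z \<in> normal_space M f p \<and> ?w - z \<in> tangent_image M f p"
    then obtain w where w: "?w - z = ?D w"
      by (auto simp: tangent_image_def pushforward_def)
    have normal: "z \<bullet> ?D y = 0" for y
      using z by (auto simp: normal_space_def tangent_image_def pushforward_def orthogonal_comp_def
          orthogonal_def inner_commute)
    have "z - sff (point_at M p) u v = ?D (christoffel (local_metric M p) (point_at M p) u v - w)"
      using w by (simp add: sff_def linear_diff[OF linear_dF[OF point_at]] algebra_simps)
    then have "z - sff (point_at M p) u v = 0"
      by (rule tangent_normal_zero[OF point_at]) (simp add: inner_diff_left normal sff_normal[OF point_at])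
    then show "z = sff (point_at M p) u v" by simp
  qed
  then show ?thesis
    by (simp add: second_fundamental_form_def)
qed

lemma bilinear_h: "bilinear h"
proof -
  have "h = sff (point_at M p)"
    by (intro ext) (rule second_fundamental_form_eq)
  then show ?thesis
    using bilinear_sff[OF point_at] by simp
qed

lemma h_commute: "h u v = h v u"
  by (simp add: second_fundamental_form_eq sff_commute[OF point_at])

lemma gauss:
  "tangent_inner M p (riemann_curvature (local_metric M p) (point_at M p) u v v) u = sff_curvature h u v"
  unfolding tangent_inner_def gauss_equation[OF point_at] sff_curvature_def second_fundamental_form_eq
  by (simp add: inner_commute sff_commute[OF point_at, of v u])

lemma sectional_curvature_eq:
  assumes ab: "a \<noteq> b" "orthonormal_wrt (tangent_inner M p) {a, b}"
  shows "sectional_curvature M p (span {a, b}) = sff_curvature h a b"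
proof -
  define uv where "uv = (SOME (u, v). u \<noteq> v \<and> independent {u, v} \<and> span {u, v} = span {a, b})"
  obtain u v where u_v: "uv = (u, v)" by fastforce
  have "case (a, b) of (u, v) \<Rightarrow> u \<noteq> v \<and> independent {u, v} \<and> span {u, v} = span {a, b}"
    using ab orthonormal_independent by simp
  then have "case uv of (u, v) \<Rightarrow> u \<noteq> v \<and> independent {u, v} \<and> span {u, v} = span {a, b}"
    unfolding uv_def by (rule someI)
  then have "u \<noteq> v" "independent {u, v}" "span {u, v} = span {a, b}"
    by (auto simp: u_v)
  then show ?thesis
    using curvature_quotient[OF bilinear_h h_commute ab, of u v] u_v
    by (simp add: sectional_curvature_def uv_def[symmetric] gauss)
qed

section \<open>Ricci and mean curvature in an arbitrary orthonormal basis\<close>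

lemma orthonormal_basis_iff:
  "orthonormal_basis M p B \<longleftrightarrow> orthonormal_wrt (tangent_inner M p) B \<and> span B = UNIV"
  using orthonormal_independent by (auto simp: orthonormal_basis_def orthonormal_wrt_def)

lemma card_orthonormal_basis:
  assumes "orthonormal_basis M p B"
  shows "card B = CARD('n)"
  using assms dim_eq_card_independent[of B] dim_span[of B] by (simp add: orthonormal_basis_def dim_UNIV)

lemma orthonormal_basis_extend:
  assumes "orthonormal_wrt (tangent_inner M p) E"
  obtains B where "orthonormal_basis M p B" "E \<subseteq> B"
  using orthonormal_extend[OF assms subset_UNIV subspace_UNIV] unfolding orthonormal_basis_iff by metis

text \<open>The basis \<open>B\<close> need not contain \<open>X\<close>. In a basis containing
  \<open>X\<close> the omitted term may be added, as it is zero, and the full sum is a trace, hence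
  the same in every orthonormal basis.\<close>

lemma ricci_eq:
  assumes X: "X \<in> unit_tangent M p" and B: "orthonormal_basis M p B"
  shows "ricci M p X = (\<Sum>e\<in>B. sff_curvature h X e)"
proof -
  define C where "C = (SOME C. orthonormal_basis M p C \<and> X \<in> C)"
  have "orthonormal_wrt (tangent_inner M p) {X}"
    using X by (simp add: orthonormal_wrt_def unit_tangent_def)
  then have "\<exists>C. orthonormal_basis M p C \<and> X \<in> C"
    by (metis orthonormal_basis_extend insert_subset)
  then have C: "orthonormal_basis M p C" "X \<in> C"
    unfolding C_def by (metis (mono_tags, lifting) someI_ex)+
  have "ricci M p X = (\<Sum>e\<in>C - {X}. sectional_curvature M p (span {X, e}))"
    by (simp add: ricci_def C_def)
  also have "\<dots> = (\<Sum>e\<in>C - {X}. sff_curvature h X e)"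
    using C by (intro sum.cong refl sectional_curvature_eq) (auto simp: orthonormal_basis_iff orthonormal_wrt_def)
  also have "\<dots> = (\<Sum>e\<in>C. sff_curvature h X e)"
    using C orthonormal_finite by (simp add: sum_diff1 sff_curvature_def orthonormal_basis_iff)
  also have "\<dots> = (\<Sum>e\<in>B. sff_curvature h X e)"
  proof -
    \<comment> \<open>A bilinear form with diagonal values
      \<open>sff_curvature h X e\<close>.\<close>
    let ?\<phi> = "\<lambda>e e'. h X X \<bullet> h e e' - h X e \<bullet> h X e'"
    have "bilinear ?\<phi>"
      unfolding bilinear_def
      by (auto intro!: linearI simp: bilinear_ladd[OF bilinear_h] bilinear_radd[OF bilinear_h]
          bilinear_lmul[OF bilinear_h] bilinear_rmul[OF bilinear_h] inner_add_left inner_add_right algebra_simps)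
    then show ?thesis
      using trace_unique[of ?\<phi> C B] B C by (simp add: orthonormal_basis_iff sff_curvature_def)
  qed
  finally show ?thesis .
qed

lemma norm_trace_h:
  assumes B: "orthonormal_basis M p B"
  shows "norm (\<Sum>e\<in>B. h e e) = real CARD('n) * mean_curvature M f p"
proof -
  let ?C = "SOME B. orthonormal_basis M p B"
  have "orthonormal_basis M p ?C"
    using B by (rule someI)
  then have "(\<Sum>e\<in>?C. h e e) = (\<Sum>e\<in>B. h e e)"
    using B trace_unique[OF bilinear_h] by (simp add: orthonormal_basis_iff)
  then show ?thesis
    by (simp add: mean_curvature_def mean_curvature_vector_def)
qed

text \<open>Orthonormal bases of the single planes have an orthonormal union, which is then
  extended. Pairs from different planes are disjoint because a common vector would be orthogonal to
  itself although it has length one.\<close>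

lemma orthogonal_planes_basis:
  assumes planes: "\<And>i. i < q \<Longrightarrow> plane_section (\<pi> i)"
    and orth: "\<And>i j. i < q \<Longrightarrow> j < q \<Longrightarrow> i \<noteq> j \<Longrightarrow> orthogonal_planes M p (\<pi> i) (\<pi> j)"
  obtains B a b where "orthonormal_basis M p B"
    "\<forall>i<q. a i \<in> B \<and> b i \<in> B \<and> a i \<noteq> b i \<and> span {a i, b i} = \<pi> i"
    "\<forall>i<q. \<forall>j<q. i \<noteq> j \<longrightarrow> {a i, b i} \<inter> {a j, b j} = {}"
proof -
  let ?g = "tangent_inner M p"
  have "\<forall>i<q. \<exists>a b. a \<noteq> b \<and> orthonormal_wrt ?g {a, b} \<and> span {a, b} = \<pi> i"
    using planes unfolding plane_section_def by (metis plane_orthonormal_basis)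
  then obtain a b where ab: "\<And>i. i < q \<Longrightarrow> a i \<noteq> b i \<and> orthonormal_wrt ?g {a i, b i} \<and> span {a i, b i} = \<pi> i"
    by metis
  have cross: "?g u v = 0" if "i < q" "j < q" "i \<noteq> j" "u \<in> {a i, b i}" "v \<in> {a j, b j}" for i j u v
  proof -
    have "u \<in> \<pi> i" "v \<in> \<pi> j"
      using ab[OF that(1)] ab[OF that(2)] that(4,5) by (metis span_base)+
    then show ?thesis
      using orth that(1-3) by (auto simp: orthogonal_planes_def)
  qed
  have unit: "?g u u = 1" if "i < q" "u \<in> {a i, b i}" for i u
    using ab[OF that(1)] that(2) unfolding orthonormal_wrt_def by auto
  have disj: "{a i, b i} \<inter> {a j, b j} = {}" if "i < q" "j < q" "i \<noteq> j" for i j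
  proof (rule ccontr)
    assume "{a i, b i} \<inter> {a j, b j} \<noteq> {}"
    then obtain u where u: "u \<in> {a i, b i}" "u \<in> {a j, b j}" by blast
    from cross[OF that u] unit[OF that(1) u(1)] show False by simp
  qed
  have "orthonormal_wrt ?g (\<Union>i<q. {a i, b i})"
    unfolding orthonormal_wrt_def
  proof (intro ballI)
    fix u v assume "u \<in> (\<Union>i<q. {a i, b i})" "v \<in> (\<Union>i<q. {a i, b i})"
    then obtain i j where ij: "i < q" "u \<in> {a i, b i}" "j < q" "v \<in> {a j, b j}"
      by blast
    show "?g u v = (if u = v then 1 else 0)"
    proof (cases "i = j")
      case True
      then show ?thesis
        using ab[OF ij(1)] ij(2,4) unfolding orthonormal_wrt_def by auto
    next
      case False
      then show ?thesis
        using cross[OF ij(1,3) False ij(2,4)] disj[OF ij(1,3) False] ij(2,4) by auto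
    qed
  qed
  then obtain B where "orthonormal_basis M p B" "(\<Union>i<q. {a i, b i}) \<subseteq> B"
    by (rule orthonormal_basis_extend)
  then show thesis
    by (intro that[of B a b]) (use ab disj in \<open>auto simp: subset_eq\<close>)
qed

text \<open>Successive pairs of one orthonormal basis span such planes. This keeps the infimum in
  \<open>K_inf\<close> from ranging over the empty set.\<close>

lemma exists_orthogonal_planes:
  assumes "2 * q \<le> CARD('n)"
  obtains \<pi> where "\<And>i. i < q \<Longrightarrow> plane_section (\<pi> i)"
    "\<And>i j. i < q \<Longrightarrow> j < q \<Longrightarrow> i \<noteq> j \<Longrightarrow> orthogonal_planes M p (\<pi> i) (\<pi> j)"
proof -
  obtain B where B: "orthonormal_basis M p B"
    using orthonormal_basis_extend[of "{}"] by (auto simp: orthonormal_wrt_def)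
  then have "finite B" "card B = CARD('n)"
    using orthonormal_finite card_orthonormal_basis by (auto simp: orthonormal_basis_iff)
  then obtain e where e: "bij_betw e {..<CARD('n)} B"
    by (metis ex_bij_betw_nat_finite lessThan_atLeast0)
  have eB: "e k \<in> B" if "k < CARD('n)" for k
    using e that by (auto simp: bij_betw_def)
  have ee: "tangent_inner M p (e k) (e l) = (if k = l then 1 else 0)" if "k < CARD('n)" "l < CARD('n)" for k l
    using e B that by (auto simp: bij_betw_def inj_on_eq_iff orthonormal_basis_iff orthonormal_wrt_def)
  let ?\<pi> = "\<lambda>i. span {e (2 * i), e (2 * i + 1)}"
  show thesis
  proof (rule that)
    fix i assume i: "i < q"
    then have less: "2 * i < CARD('n)" "2 * i + 1 < CARD('n)"
      using assms by linarith+
    then have ne: "e (2 * i) \<noteq> e (2 * i + 1)"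
      using ee[OF less(1) less(1)] ee[OF less] by auto
    moreover have "independent {e (2 * i), e (2 * i + 1)}"
      by (rule independent_mono[of B]) (use i assms B eB in \<open>auto simp: orthonormal_basis_def\<close>)
    ultimately show "plane_section (?\<pi> i)"
      by (simp add: plane_section_def dim_eq_card_independent)
  next
    fix i j assume ij: "i < q" "j < q" "i \<noteq> j"
    have "2 * i \<noteq> Suc (2 * j)" "Suc (2 * i) \<noteq> 2 * j" by presburger+
    then have gen: "tangent_inner M p u v = 0" if "u \<in> {e (2 * i), e (2 * i + 1)}" "v \<in> {e (2 * j), e (2 * j + 1)}" for u v
      using that ij assms by (auto simp: ee)
    \<comment> \<open>The metric agrees with the zero form on the generators, so by bilinearity also
      on their spans.\<close>
    have "bilinear (\<lambda>(u :: real ^ 'n) (v :: real ^ 'n). 0 :: real)"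
      by (auto simp: bilinear_def intro: linearI)
    then have "tangent_inner M p u v = 0" if "u \<in> ?\<pi> i" "v \<in> ?\<pi> j" for u v
      by (rule bilinear_eq[OF bilin _ order_refl order_refl that]) (rule gen)
    then show "orthogonal_planes M p (?\<pi> i) (?\<pi> j)"
      by (simp add: orthogonal_planes_def)
  qed
qed

text \<open>If \<open>M\<close> is Einstein, then \<open>r = 2 \<tau>(p) / n\<close>, so this is Chen's inequality for
  \<open>\<delta>(2, \<dots>, 2)\<close>.\<close>

lemma sectional_sum_ge:
  assumes ricci: "\<And>X. X \<in> unit_tangent M p \<Longrightarrow> ricci M p X = r"
    and q: "q > 0" "2 * q \<le> CARD('n)"
    and planes: "\<And>i. i < q \<Longrightarrow> plane_section (\<pi> i)"
    and orth: "\<And>i j. i < q \<Longrightarrow> j < q \<Longrightarrow> i \<noteq> j \<Longrightarrow> orthogonal_planes M p (\<pi> i) (\<pi> j)"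
  shows "r - 2 / real CARD('n) * (\<Sum>i<q. sectional_curvature M p (\<pi> i))
    \<le> real CARD('n) * (real CARD('n) - real q - 1) / (real CARD('n) - real q) * (mean_curvature M f p)\<^sup>2"
proof -
  let ?n = "real CARD('n)"
  obtain B a b where B: "orthonormal_basis M p B"
    and ab: "\<forall>i<q. a i \<in> B \<and> b i \<in> B \<and> a i \<noteq> b i \<and> span {a i, b i} = \<pi> i"
    and disj: "\<forall>i<q. \<forall>j<q. i \<noteq> j \<longrightarrow> {a i, b i} \<inter> {a j, b j} = {}"
    by (rule orthogonal_planes_basis[OF planes orth])
  have "sectional_curvature M p (\<pi> i) = sff_curvature h (a i) (b i)" if "i < q" for i
    using sectional_curvature_eq[of "a i" "b i"] ab that B
    by (auto simp: orthonormal_basis_iff orthonormal_wrt_def)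
  then have K: "(\<Sum>i<q. sectional_curvature M p (\<pi> i)) = (\<Sum>i<q. sff_curvature h (a i) (b i))"
    by simp
  have "(\<Sum>e'\<in>B. sff_curvature h e e') = r" if "e \<in> B" for e
  proof -
    have "e \<in> unit_tangent M p"
      using that B by (simp add: orthonormal_basis_def unit_tangent_def)
    then show ?thesis using ricci ricci_eq B by metis
  qed
  \<comment> \<open>Each pair of distinct basis vectors is counted twice, so the double sum is twice
    the scalar curvature \<open>\<tau>\<close>.\<close>
  then have "?n * r = (\<Sum>e\<in>B. \<Sum>e'\<in>B. sff_curvature h e e')"
    using card_orthonormal_basis[OF B] by simp
  moreover have "finite B"
    using B orthonormal_finite by (simp add: orthonormal_basis_iff)
  then have "(\<Sum>e\<in>B. \<Sum>e'\<in>B. sff_curvature h e e') - 2 * (\<Sum>i<q. sff_curvature h (a i) (b i))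
      \<le> (1 - 1 / (real (card B) - real q)) * (norm (\<Sum>e\<in>B. h e e))\<^sup>2"
    by (rule paired_curvature_bound[OF h_commute]) (use ab disj q(1) in blast)+
  ultimately have "?n * r - 2 * (\<Sum>i<q. sectional_curvature M p (\<pi> i))
      \<le> (1 - 1 / (?n - real q)) * (?n * mean_curvature M f p)\<^sup>2"
    by (simp add: K card_orthonormal_basis[OF B] norm_trace_h[OF B])
  then have "(?n * r - 2 * (\<Sum>i<q. sectional_curvature M p (\<pi> i))) / ?n
      \<le> (1 - 1 / (?n - real q)) * (?n * mean_curvature M f p)\<^sup>2 / ?n"
    by (intro divide_right_mono) auto
  moreover have "(?n * r - 2 * (\<Sum>i<q. sectional_curvature M p (\<pi> i))) / ?n
      = r - 2 / ?n * (\<Sum>i<q. sectional_curvature M p (\<pi> i))"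
    by (simp add: diff_divide_distrib)
  moreover have "(1 - 1 / (?n - real q)) * (?n * mean_curvature M f p)\<^sup>2 / ?n
      = ?n * (?n - real q - 1) / (?n - real q) * (mean_curvature M f p)\<^sup>2"
  proof -
    have "?n - real q > 0" using q by linarith
    then have "1 - 1 / (?n - real q) = (?n - real q - 1) / (?n - real q)"
      by (simp add: diff_divide_distrib)
    then show ?thesis by (simp add: power_mult_distrib power2_eq_square)
  qed
  ultimately show ?thesis by simp
qed

text \<open>With constant Ricci curvature the supremum is \<open>r\<close>. The estimate
  \<open>sectional_sum_ge\<close> for every family of planes bounds \<open>K_inf\<close> from below,
  which is an upper bound for \<open>delta_Ric\<close> because \<open>K_inf\<close> enters
  negatively.\<close>

lemma delta_Ric_le:
  assumes ricci: "\<And>X. X \<in> unit_tangent M p \<Longrightarrow> ricci M p X = r"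
    and q: "q > 0" "2 * q \<le> CARD('n)"
  shows "delta_Ric M q p
    \<le> real CARD('n) * (real CARD('n) - real q - 1) / (real CARD('n) - real q) * (mean_curvature M f p)\<^sup>2"
    (is "_ \<le> ?b")
proof -
  let ?n = "real CARD('n)"
  obtain B where B: "orthonormal_basis M p B"
    using orthonormal_basis_extend[of "{}"] by (auto simp: orthonormal_wrt_def)
  then obtain e where "e \<in> B"
    using card_orthonormal_basis[OF B] by fastforce
  then have "e \<in> unit_tangent M p"
    using B by (simp add: orthonormal_basis_def unit_tangent_def)
  then have "unit_tangent M p \<noteq> {}" by blast
  then have sup: "(SUP X\<in>unit_tangent M p. ricci M p X) = r"
    using ricci by (simp cong: SUP_cong_simp)
  let ?K = "{(\<Sum>i<q. sectional_curvature M p (\<pi> i)) / real q | \<pi> :: nat \<Rightarrow> (real ^ 'n) set.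
     (\<forall>i<q. plane_section (\<pi> i)) \<and>
     (\<forall>i<q. \<forall>j<q. i \<noteq> j \<longrightarrow> orthogonal_planes M p (\<pi> i) (\<pi> j))}"
  \<comment> \<open>The constant comes from solving \<open>r - 2 * real q / ?n * k \<le> ?b\<close>
    for \<open>k\<close>.\<close>
  have "?n / (2 * real q) * (r - ?b) \<le> Inf ?K"
  proof (rule cInf_greatest)
    show "?K \<noteq> {}"
      using exists_orthogonal_planes[OF q(2)] by (smt (verit) Collect_empty_eq)
  next
    fix k assume "k \<in> ?K"
    then obtain \<pi> where \<pi>: "k = (\<Sum>i<q. sectional_curvature M p (\<pi> i)) / real q"
      "\<And>i. i < q \<Longrightarrow> plane_section (\<pi> i)"
      "\<And>i j. i < q \<Longrightarrow> j < q \<Longrightarrow> i \<noteq> j \<Longrightarrow> orthogonal_planes M p (\<pi> i) (\<pi> j)"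
      by blast
    have "r - ?b \<le> 2 / ?n * (real q * k)"
      using sectional_sum_ge[where \<pi> = \<pi>, OF ricci q \<pi>(2,3)] q(1) by (simp add: \<pi>(1))
    then have "?n / (2 * real q) * (r - ?b) \<le> ?n / (2 * real q) * (2 / ?n * (real q * k))"
      by (intro mult_left_mono) auto
    also have "\<dots> = k" using q(1) by simp
    finally show "?n / (2 * real q) * (r - ?b) \<le> k" .
  qed
  then have "?n / (2 * real q) * (r - ?b) \<le> K_inf M q p"
    by (simp add: K_inf_def)
  then have "2 * real q / ?n * (?n / (2 * real q) * (r - ?b)) \<le> 2 * real q / ?n * K_inf M q p"
    by (intro mult_left_mono) auto
  moreover have "2 * real q / ?n * (?n / (2 * real q) * (r - ?b)) = r - ?b"
    using q(1) by simp
  ultimately show ?thesis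
    by (simp add: delta_Ric_def sup)
qed

end

theorem corollary5p1:
  fixes M :: "('m, 'n::finite) riemannian_data"
    and f :: "'m \<Rightarrow> complex ^ 'k::finite"
    and q :: nat and p :: 'm
  assumes "riemannian_manifold M"
    and "isometric_immersion M f"
    and "totally_real M f"
    and "q > 0" and "real q \<le> real CARD('n) / 2"
    and "p \<in> points M"
    and "delta_Ric M q p >
      real CARD('n) * (real CARD('n) - real q - 1) / (real CARD('n) - real q) * (mean_curvature M f p)\<^sup>2"
  shows "\<not> einstein M"
proof
  assume "einstein M"
  then have "\<exists>r. \<forall>X\<in>unit_tangent M p. ricci M p X = r"
    using \<open>p \<in> points M\<close> unfolding einstein_def by meson
  then obtain r where "\<And>X. X \<in> unit_tangent M p \<Longrightarrow> ricci M p X = r"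
    by blast
  moreover interpret immersed_point M f p
    by unfold_locales fact+
  have "2 * q \<le> CARD('n)"
    using \<open>real q \<le> real CARD('n) / 2\<close> by linarith
  ultimately show False
    using delta_Ric_le[of r q] \<open>q > 0\<close> assms(7) by auto
qed

end
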